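(* For $u\in\mathrm{Sp}(1)$, $\epsilon_1,\epsilon_2\in\{\pm1\}$, $t\in\mathbb{R}$ and $q\in\mathbb{B}$ define \[ (u,\epsilon_1,H(t),\epsilon_2)\cdot q=\begin{cases}\epsilon_1u(1+\tanh(t)q)^{-1}(q+\tanh(t))\overline{u}, & \epsilon_2=+1,\\ \epsilon_1u(1+\tanh(t)\overline{q})^{-1}(\overline{q}+\tanh(t))\overline{u}, & \epsilon_2=-1.\end{cases} \] These maps define a left action of the group $\mathrm{Sp}(1)\times(\mathbb{Z}_2\ltimes\mathrm{SO}_0(1,1))\times\mathbb{Z}_2$ on $\mathbb{B}$, and the set of transformations given by this action is the full isometry group of $(\mathbb{B},g)$, where $g$ is the slice Riemannian metric.
   Context: $\mathbb{H}$ denotes the quaternions, $\mathbb{B}=\{q\in\mathbb{H}:|q|<1\}$, $\mathrm{Sp}(1)=\{u\in\mathbb{H}:|u|=1\}$, $\mathbb{Z}_2=\{\pm1\}$ under multiplication. For $t\in\mathbb{R}$, $H(t)=\begin{pmatrix}\cosh t&\sinh t\\ \sinh t&\cosh t\end{pmatrix}$ and $\mathrm{SO}_0(1,1)=\{H(t):t\in\mathbb{R}\}$. The group $\mathbb{Z}_2\ltimes\mathrm{SO}_0(1,1)$ is the set $\{\pm1\}\times\mathrm{SO}_0(1,1)$ with product $(\epsilon_1,H(t_1))\star(\epsilon_2,H(t_2))=(\epsilon_1\epsilon_2,H(\epsilon_2t_1+t_2))$; the group $\mathrm{Sp}(1)\times(\mathbb{Z}_2\ltimes\mathrm{SO}_0(1,1))\times\mathbb{Z}_2$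 carries the direct product structure of its three factors. The slice Riemannian metric on $\mathbb{B}$ is, for $q\in\mathbb{B}$ and $\alpha,\beta\in T_q\mathbb{B}=\mathbb{H}$, \[ g_q(\alpha,\beta)=\frac{\operatorname{Re}\big((\alpha-q\alpha q)\overline{(\beta-q\beta q)}\big)}{|1-q^2|^2(1-|q|^2)^2}. \] *)

theory Defs
  imports "HOL-Analysis.Analysis"
begin

text \<open>Quaternions H are modelled as real \<times> real \<times> real \<times> real, i.e. q = a + b i + c j + d k
  is (a, b, c, d). The product-type norm is the Euclidean norm, so norm q = |q|.\<close>

type_synonym quat = "real \<times> real \<times> real \<times> real"

definition qmult :: "quat \<Rightarrow> quat \<Rightarrow> quat" (infixl "\<star>\<^sub>q" 70) where
  "qmult p q = (case p of (a1, b1, c1, d1) \<Rightarrow> case q of (a2, b2, c2, d2) \<Rightarrow>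
     (a1*a2 - b1*b2 - c1*c2 - d1*d2,
      a1*b2 + b1*a2 + c1*d2 - d1*c2,
      a1*c2 - b1*d2 + c1*a2 + d1*b2,
      a1*d2 + b1*c2 - c1*b2 + d1*a2))"

definition qcnj :: "quat \<Rightarrow> quat" where
  "qcnj q = (case q of (a, b, c, d) \<Rightarrow> (a, -b, -c, -d))"

definition qre :: "quat \<Rightarrow> real" where
  "qre q = fst q"

definition qreal :: "real \<Rightarrow> quat" where
  "qreal r = (r, 0, 0, 0)"

definition qinv :: "quat \<Rightarrow> quat" where
  "qinv q = scaleR (1 / (norm q)\<^sup>2) (qcnj q)"

definition qball :: "quat set" where
  "qball = {q. norm q < 1}"

definition Sp1 :: "quat set" where
  "Sp1 = {u. norm u = 1}"

definition slice_metric :: "quat \<Rightarrow> quat \<Rightarrow> quat \<Rightarrow> real" where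
  "slice_metric q \<alpha> \<beta> =
     qre ((\<alpha> - q \<star>\<^sub>q \<alpha> \<star>\<^sub>q q) \<star>\<^sub>q qcnj (\<beta> - q \<star>\<^sub>q \<beta> \<star>\<^sub>q q))
     / ((norm (qreal 1 - q \<star>\<^sub>q q))\<^sup>2 * (1 - (norm q)\<^sup>2)\<^sup>2)"

definition slice_isometry :: "(quat \<Rightarrow> quat) \<Rightarrow> bool" where
  "slice_isometry f \<longleftrightarrow>
     f \<in> extensional qball \<and>
     bij_betw f qball qball \<and>
     f differentiable_on qball \<and>
     (inv_into qball f) differentiable_on qball \<and>
     (\<forall>q\<in>qball. \<forall>f'. (f has_derivative f') (at q) \<longrightarrow>
        (\<forall>\<alpha> \<beta>. slice_metric (f q) (f' \<alpha>) (f' \<beta>) = slice_metric q \<alpha> \<beta>))"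

text \<open>The group Sp(1) \<times> (Z2 \<ltimes> SO_0(1,1)) \<times> Z2. The element (u, (e1, H(t)), e2) is represented
  by (u, (e1, t), e2), using that t \<mapsto> H(t) is a bijection R \<rightarrow> SO_0(1,1); Z2 = {1, -1} \<subseteq> R.\<close>
type_synonym grp = "quat \<times> (real \<times> real) \<times> real"

definition grp_carrier :: "grp set" where
  "grp_carrier = {(u, (e1, t), e2). u \<in> Sp1 \<and> e1 \<in> {1, -1} \<and> e2 \<in> {1, -1}}"

definition grp_mult :: "grp \<Rightarrow> grp \<Rightarrow> grp" where
  "grp_mult g h = (case g of (u1, (a1, t1), b1) \<Rightarrow> case h of (u2, (a2, t2), b2) \<Rightarrow>
     (u1 \<star>\<^sub>q u2, (a1 * a2, a2 * t1 + t2), b1 * b2))"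

definition grp_one :: grp where
  "grp_one = (qreal 1, (1, 0), 1)"

definition grp_act :: "grp \<Rightarrow> quat \<Rightarrow> quat" where
  "grp_act g q = (case g of (u, (e1, t), e2) \<Rightarrow>
     (if e2 = 1
      then scaleR e1 (u \<star>\<^sub>q qinv (qreal 1 + scaleR (tanh t) q) \<star>\<^sub>q (q + qreal (tanh t)) \<star>\<^sub>q qcnj u)
      else scaleR e1 (u \<star>\<^sub>q qinv (qreal 1 + scaleR (tanh t) (qcnj q)) \<star>\<^sub>q (qcnj q + qreal (tanh t)) \<star>\<^sub>q qcnj u)))"

end

theory Submission
  imports Defs
begin

text \<open>
  In Fermi coordinates around the real axis, \<open>4 g = dr\<^sup>2 + cosh\<^sup>2 r ds\<^sup>2 + tanh\<^sup>2 r d\<Omega>\<^sup>2\<close>, with \<open>\<Omega>\<close> on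
  the unit sphere of imaginary quaternions, and the group acts by \<open>s \<mapsto> \<plusminus>s + c\<close> and by \<open>O(3)\<close> on \<open>\<Omega>\<close>.
  Euclidean segments from \<open>0\<close> are minimizing geodesics, since \<open>artanh |q|\<close> is 1-Lipschitz and the
  only directions realizing its slope are radial.  Hence an isometry \<open>f\<close> with \<open>f 0 = 0\<close> is the
  restriction of a linear orthogonal map; it preserves the real axis, because this is exactly where
  \<open>g\<close> is conformal to the Euclidean metric, and so it is given by an element of \<open>O(1) \<times> O(3)\<close>.
  For general \<open>f\<close>, a real Moebius transformation makes \<open>f 0\<close> imaginary.  If \<open>f 0 \<noteq> 0\<close>, all geodesics
  from \<open>f 0\<close> would be minimizing, including the one through \<open>0\<close>; but two points of that line on
  opposite sides of \<open>0\<close>, at distances \<open>r\<close> and \<open>R\<close> from it, are joined by a helix of length at most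
  \<open>sqrt ((R - r)\<^sup>2 + \<pi>\<^sup>2)\<close>, which is less than \<open>R + r\<close> for large \<open>R\<close>.  Only first derivatives of \<open>f\<close>
  along curves enter, so differentiability suffices.
\<close>

section \<open>Quaternion algebra\<close>

lemma qmult_assoc: "p \<star>\<^sub>q q \<star>\<^sub>q r = p \<star>\<^sub>q (q \<star>\<^sub>q r)"
  by (cases p; cases q; cases r) (simp add: qmult_def algebra_simps)

lemma norm_qmult: "norm (p \<star>\<^sub>q q) = norm p * norm q"
proof -
  have "(norm (p \<star>\<^sub>q q))\<^sup>2 = (norm p * norm q)\<^sup>2"
    unfolding power_mult_distrib power2_norm_eq_inner
    by (cases p; cases q) (simp add: qmult_def algebra_simps)
  then show ?thesis
    by (simp add: power2_eq_iff_nonneg)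
qed

lemma bounded_bilinear_qmult: "bounded_bilinear (\<star>\<^sub>q)"
proof
  show "\<exists>K. \<forall>a b. norm (a \<star>\<^sub>q b) \<le> norm a * norm b * K"
    by (rule exI[of _ 1]) (simp add: norm_qmult)
qed (auto simp: qmult_def algebra_simps split: prod.splits)

interpretation qmult: bounded_bilinear "(\<star>\<^sub>q)"
  by (rule bounded_bilinear_qmult)

lemma qcnj_qmult: "qcnj (p \<star>\<^sub>q q) = qcnj q \<star>\<^sub>q qcnj p"
  by (cases p; cases q) (simp add: qmult_def qcnj_def algebra_simps)

lemma norm_qcnj [simp]: "norm (qcnj q) = norm q"
  by (cases q) (simp add: qcnj_def norm_eq_sqrt_inner)

lemma qcnj_qcnj [simp]: "qcnj (qcnj q) = q"
  by (cases q) (simp add: qcnj_def)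

lemma bounded_linear_qcnj: "bounded_linear qcnj"
proof (rule bounded_linear_intro)
  show "norm (qcnj q) \<le> norm q * 1" for q
    by simp
qed (auto simp: qcnj_def split: prod.splits)

lemmas linear_qcnj = bounded_linear.linear[OF bounded_linear_qcnj]

lemma qcnj_qreal [simp]: "qcnj (qreal r) = qreal r"
  by (simp add: qcnj_def qreal_def)

lemma qmult_qreal [simp]: "q \<star>\<^sub>q qreal r = r *\<^sub>R q" "qreal r \<star>\<^sub>q q = r *\<^sub>R q"
  by (cases q; simp add: qmult_def qreal_def)+

lemma norm_qreal [simp]: "norm (qreal r) = \<bar>r\<bar>"
  by (simp add: qreal_def norm_Pair)

lemma qmult_qcnj: "q \<star>\<^sub>q qcnj q = qreal ((norm q)\<^sup>2)" "qcnj q \<star>\<^sub>q q = qreal ((norm q)\<^sup>2)"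
  unfolding power2_norm_eq_inner
  by (cases q; simp add: qmult_def qcnj_def qreal_def)+

lemma qre_qmult_qcnj: "qre (p \<star>\<^sub>q qcnj q) = p \<bullet> q"
  by (cases p; cases q) (simp add: qmult_def qcnj_def qre_def)

lemma qinv_right: "q \<noteq> 0 \<Longrightarrow> q \<star>\<^sub>q qinv q = qreal 1"
  by (simp add: qinv_def qmult.scaleR_right qmult_qcnj) (simp add: qreal_def)

lemma qinv_left: "q \<noteq> 0 \<Longrightarrow> qinv q \<star>\<^sub>q q = qreal 1"
  by (simp add: qinv_def qmult.scaleR_left qmult_qcnj) (simp add: qreal_def)

lemma norm_qinv: "norm (qinv q) = 1 / norm q"
  by (simp add: qinv_def power2_eq_square)

lemma qmult_left_cancel: "p \<noteq> 0 \<Longrightarrow> p \<star>\<^sub>q q = p \<star>\<^sub>q r \<longleftrightarrow> q = r"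
  by (metis qinv_left qmult_assoc qmult_qreal(2) scaleR_one)

lemma qmult_inner_left: "(p \<star>\<^sub>q q) \<bullet> (p \<star>\<^sub>q r) = (norm p)\<^sup>2 * (q \<bullet> r)"
  unfolding power2_norm_eq_inner
  by (cases p; cases q; cases r) (simp add: qmult_def algebra_simps)

lemma qmult_inner_right: "(q \<star>\<^sub>q p) \<bullet> (r \<star>\<^sub>q p) = (norm p)\<^sup>2 * (q \<bullet> r)"
  unfolding power2_norm_eq_inner
  by (cases p; cases q; cases r) (simp add: qmult_def algebra_simps)

lemma qcnj_inner: "qcnj p \<bullet> qcnj q = p \<bullet> q"
  by (cases p; cases q) (simp add: qcnj_def)

lemma qball_iff: "q \<in> qball \<longleftrightarrow> norm q < 1"
  by (simp add: qball_def)

lemma open_qball: "open qball"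
proof -
  have "qball = ball (0 :: quat) 1"
    by (auto simp: qball_def)
  then show ?thesis
    by (metis open_ball)
qed

section \<open>The slice metric as a quadratic form\<close>

lemma slice_metric_inner:
  "slice_metric q \<alpha> \<beta> = (\<alpha> - q \<star>\<^sub>q \<alpha> \<star>\<^sub>q q) \<bullet> (\<beta> - q \<star>\<^sub>q \<beta> \<star>\<^sub>q q)
    / ((norm (qreal 1 - q \<star>\<^sub>q q))\<^sup>2 * (1 - (norm q)\<^sup>2)\<^sup>2)"
  by (simp add: slice_metric_def qre_qmult_qcnj)

lemma norm_one_minus_square:
  "(norm (qreal 1 - (x, b) \<star>\<^sub>q (x, b)))\<^sup>2 = (1 - (norm (x, b))\<^sup>2)\<^sup>2 + 4 * (norm b)\<^sup>2"
  unfolding power2_norm_eq_inner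
  by (cases b) (simp add: qmult_def qreal_def power2_eq_square algebra_simps)

lemma inner_sandwich:
  "(a, v) \<bullet> ((x, b) \<star>\<^sub>q (a, v) \<star>\<^sub>q (x, b)) =
    (norm (x, b))\<^sup>2 * (norm (a, v))\<^sup>2 - 2 * ((norm b)\<^sup>2 * a\<^sup>2 + (b \<bullet> v)\<^sup>2)"
  unfolding power2_norm_eq_inner
  by (cases b; cases v) (simp add: qmult_def power2_eq_square algebra_simps)

text \<open>Split the tangent vector at \<open>(x, b)\<close> along the slice plane spanned by 1 and
  \<open>b\<close>. The formula then says that \<open>g\<close> is the Poincare metric, with factor
  \<open>1 / n^2\<close>, on the slice plane, and has factor \<open>1 / (n^2 + 4 |b|^2)\<close> on
  its orthogonal complement. The second factor stays bounded away from the real axis, and both agree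
  exactly when \<open>b = 0\<close>.\<close>

lemma slice_metric_quadratic:
  fixes x a :: real and b v :: "real \<times> real \<times> real"
  defines "n \<equiv> 1 - (norm (x, b))\<^sup>2"
  shows "slice_metric (x, b) (a, v) (a, v) =
    (n\<^sup>2 * (norm (a, v))\<^sup>2 + 4 * ((norm b)\<^sup>2 * a\<^sup>2 + (b \<bullet> v)\<^sup>2)) / ((n\<^sup>2 + 4 * (norm b)\<^sup>2) * n\<^sup>2)"
proof -
  let ?q = "(x, b)" and ?\<alpha> = "(a, v)"
  define s where "s = ?q \<star>\<^sub>q ?\<alpha> \<star>\<^sub>q ?q"
  have "(?\<alpha> - s) \<bullet> (?\<alpha> - s) = (norm ?\<alpha>)\<^sup>2 - 2 * (?\<alpha> \<bullet> s) + (norm s)\<^sup>2"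
    unfolding power2_norm_eq_inner inner_diff_left inner_diff_right inner_commute[of s ?\<alpha>] by simp
  also have "\<dots> = n\<^sup>2 * (norm ?\<alpha>)\<^sup>2 + 4 * ((norm b)\<^sup>2 * a\<^sup>2 + (b \<bullet> v)\<^sup>2)"
    unfolding s_def inner_sandwich norm_qmult n_def by algebra
  finally show ?thesis
    unfolding slice_metric_inner norm_one_minus_square n_def s_def by simp
qed

lemma slice_metric_real:
  assumes "\<bar>x\<bar> < 1"
  shows "slice_metric (x, 0) \<alpha> \<alpha> = (norm \<alpha>)\<^sup>2 / (1 - x\<^sup>2)\<^sup>2"
proof -
  have "x\<^sup>2 < 1"
    using assms by (simp add: abs_square_less_1)
  then show ?thesis
    by (cases \<alpha>) (simp add: slice_metric_quadratic norm_Pair[of x] divide_simps)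
qed

lemma slice_metric_zero: "slice_metric 0 \<alpha> \<beta> = \<alpha> \<bullet> \<beta>"
  by (simp add: slice_metric_inner qmult.zero_left)

lemma qball_norm_power2: "q \<in> qball \<Longrightarrow> (norm q)\<^sup>2 < 1"
  by (simp add: qball_iff abs_square_less_1)

text \<open>The defect on the right-hand side is a sum of two Cauchy-Schwarz defects, the first one
  weighted by a positive factor.\<close>
lemma slice_metric_radial_defect:
  assumes "(x, b) \<in> qball"
  defines "n \<equiv> 1 - (norm (x, b))\<^sup>2"
  shows "((norm (x, b))\<^sup>2 * n\<^sup>2 * slice_metric (x, b) (a, v) (a, v) - ((x, b) \<bullet> (a, v))\<^sup>2)
      * (n\<^sup>2 + 4 * (norm b)\<^sup>2)
    = n\<^sup>2 * ((norm (x, b))\<^sup>2 * (norm (a, v))\<^sup>2 - ((x, b) \<bullet> (a, v))\<^sup>2)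
      + 4 * (x * (b \<bullet> v) - (norm b)\<^sup>2 * a)\<^sup>2"
proof -
  have n: "n > 0"
    using qball_norm_power2[OF assms(1)] by (simp add: n_def)
  have q: "(norm (x, b))\<^sup>2 = x\<^sup>2 + (norm b)\<^sup>2"
    by (simp add: norm_Pair)
  define B where "B = n\<^sup>2 + 4 * (norm b)\<^sup>2"
  have B: "B > 0"
    unfolding B_def using n by (simp add: add_pos_nonneg)
  have "n\<^sup>2 * slice_metric (x, b) (a, v) (a, v) * B =
      n\<^sup>2 * (norm (a, v))\<^sup>2 + 4 * ((norm b)\<^sup>2 * a\<^sup>2 + (b \<bullet> v)\<^sup>2)"
    unfolding slice_metric_quadratic n_def[symmetric] B_def[symmetric] using n B by simp
  then show ?thesis
    unfolding B_def q inner_Pair inner_real_def by algebra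
qed

text \<open>Away from 0, the differential of artanh |q| in direction \<open>\<alpha>\<close> is (q .
  \<alpha>) / (|q| (1 - |q|^2)). The first claim says that this function has slope at most 1 for
  \<open>g\<close>, with denominators cleared; the second that slope 1 is attained only in radial
  directions.\<close>

lemma slice_metric_radial:
  assumes "q \<in> qball"
  shows "(q \<bullet> \<alpha>)\<^sup>2 \<le> (norm q)\<^sup>2 * (1 - (norm q)\<^sup>2)\<^sup>2 * slice_metric q \<alpha> \<alpha>" (is ?le)
    and "(q \<bullet> \<alpha>)\<^sup>2 = (norm q)\<^sup>2 * (1 - (norm q)\<^sup>2)\<^sup>2 * slice_metric q \<alpha> \<alpha>
      \<Longrightarrow> (norm q)\<^sup>2 *\<^sub>R \<alpha> = (q \<bullet> \<alpha>) *\<^sub>R q" (is "?eq \<Longrightarrow> ?par")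
proof -
  obtain x b where q: "q = (x, b)" by (cases q)
  obtain a v where \<alpha>: "\<alpha> = (a, v)" by (cases \<alpha>)
  define n where "n = 1 - (norm q)\<^sup>2"
  define D where "D = (norm q)\<^sup>2 * n\<^sup>2 * slice_metric q \<alpha> \<alpha> - (q \<bullet> \<alpha>)\<^sup>2"
  define C where "C = (norm q)\<^sup>2 * (norm \<alpha>)\<^sup>2 - (q \<bullet> \<alpha>)\<^sup>2"
  have n: "n > 0"
    using qball_norm_power2[OF assms(1)] by (simp add: n_def)
  have C: "C \<ge> 0"
    using Cauchy_Schwarz_ineq[of q \<alpha>] by (simp add: C_def power2_norm_eq_inner)
  have eq: "D * (n\<^sup>2 + 4 * (norm b)\<^sup>2) = n\<^sup>2 * C + 4 * (x * (b \<bullet> v) - (norm b)\<^sup>2 * a)\<^sup>2"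
    using slice_metric_radial_defect[OF assms[unfolded q], of a v]
    unfolding D_def C_def n_def q \<alpha> .
  have pos: "n\<^sup>2 + 4 * (norm b)\<^sup>2 > 0"
    using n by (simp add: add_pos_nonneg)
  have "D * (n\<^sup>2 + 4 * (norm b)\<^sup>2) \<ge> 0"
    unfolding eq using C by simp
  then have "D \<ge> 0"
    using pos by (simp add: zero_le_mult_iff)
  then show ?le
    by (simp add: D_def n_def)
  show ?par if ?eq
  proof -
    have "D = 0"
      using that by (simp add: D_def n_def)
    then have "n\<^sup>2 * C + 4 * (x * (b \<bullet> v) - (norm b)\<^sup>2 * a)\<^sup>2 = 0"
      using eq by simp
    then have "n\<^sup>2 * C \<le> 0"
      using zero_le_power2[of "x * (b \<bullet> v) - (norm b)\<^sup>2 * a"] by linarith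
    then have "C = 0"
      using C n by (simp add: mult_le_0_iff)
    \<comment> \<open>The vector is |q|^2 times the component of \<open>\<alpha>\<close> orthogonal
      to \<open>q\<close>, and \<open>C\<close> is the Gram determinant of \<open>q\<close> and
      \<open>\<alpha>\<close>.\<close>
    moreover have "(norm ((norm q)\<^sup>2 *\<^sub>R \<alpha> - (q \<bullet> \<alpha>) *\<^sub>R q))\<^sup>2 = (norm q)\<^sup>2 * C"
      unfolding C_def power2_norm_eq_inner
      by (simp add: inner_diff_left inner_diff_right inner_commute[of \<alpha> q] power2_eq_square
          algebra_simps)
    ultimately show ?par
      by simp
  qed
qed

text \<open>A radial vector lies in the slice plane of its base point, where the metric is the
  Poincare metric; the factor \<open>B\<close> cancels.\<close>

lemma slice_metric_parallel:
  assumes "q \<in> qball"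
  shows "slice_metric q (c *\<^sub>R q) (c *\<^sub>R q) * (1 - (norm q)\<^sup>2)\<^sup>2 = c\<^sup>2 * (norm q)\<^sup>2"
proof -
  obtain x b where q: "q = (x, b)" by (cases q)
  define n where "n = 1 - (norm q)\<^sup>2"
  have n: "n > 0"
    using qball_norm_power2[OF assms(1)] by (simp add: n_def)
  have qq: "(norm q)\<^sup>2 = x\<^sup>2 + (norm b)\<^sup>2"
    by (simp add: q norm_Pair)
  define B where "B = n\<^sup>2 + 4 * (norm b)\<^sup>2"
  have B: "B > 0"
    unfolding B_def using n by (simp add: add_pos_nonneg)
  have norm_cx: "(norm (c * x, c *\<^sub>R b))\<^sup>2 = c\<^sup>2 * (norm (x, b))\<^sup>2"
    by (simp add: norm_Pair power_mult_distrib algebra_simps)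
  have "slice_metric q (c *\<^sub>R q) (c *\<^sub>R q) =
      (n\<^sup>2 * (c\<^sup>2 * (norm q)\<^sup>2) + 4 * ((norm b)\<^sup>2 * (c * x)\<^sup>2 + (c * (norm b)\<^sup>2)\<^sup>2)) / (B * n\<^sup>2)"
    unfolding q scaleR_Pair slice_metric_quadratic unfolding B_def n_def q
    by (simp add: norm_cx power_mult_distrib dot_square_norm)
  also have "\<dots> = c\<^sup>2 * (norm q)\<^sup>2 * B / (B * n\<^sup>2)"
    unfolding B_def qq by (simp add: power2_eq_square algebra_simps)
  finally show ?thesis
    using n B by (simp add: n_def)
qed

section \<open>Metric-preserving maps\<close>

text \<open>Unlike \<open>slice_isometry\<close>, this demands neither bijectivity nor the value
  \<open>undefined\<close> outside the ball, so it applies directly to maps given by formulas on all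
  of H and to their compositions. Inverses are carried along as separate metric-preserving
  maps.\<close>

definition metric_preserving :: "(quat \<Rightarrow> quat) \<Rightarrow> bool" where
  "metric_preserving f \<longleftrightarrow> (\<forall>q\<in>qball. f q \<in> qball \<and>
     (\<exists>f'. (f has_derivative f') (at q) \<and>
        (\<forall>\<alpha> \<beta>. slice_metric (f q) (f' \<alpha>) (f' \<beta>) = slice_metric q \<alpha> \<beta>)))"

lemma metric_preserving_in_qball: "metric_preserving f \<Longrightarrow> q \<in> qball \<Longrightarrow> f q \<in> qball"
  by (simp add: metric_preserving_def)

lemma metric_preserving_derivative:
  assumes "metric_preserving f" "q \<in> qball"
  obtains f' where "(f has_derivative f') (at q)"
    "\<And>\<alpha> \<beta>. slice_metric (f q) (f' \<alpha>) (f' \<beta>) = slice_metric q \<alpha> \<beta>"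
  using assms unfolding metric_preserving_def by blast

lemma metric_preserving_comp:
  assumes "metric_preserving f" "metric_preserving g"
  shows "metric_preserving (\<lambda>q. f (g q))"
  unfolding metric_preserving_def
proof (intro ballI conjI)
  fix q assume q: "q \<in> qball"
  then have gq: "g q \<in> qball"
    by (rule metric_preserving_in_qball[OF assms(2)])
  then show "f (g q) \<in> qball"
    by (rule metric_preserving_in_qball[OF assms(1)])
  obtain f' where f': "(f has_derivative f') (at (g q))"
    "\<And>\<alpha> \<beta>. slice_metric (f (g q)) (f' \<alpha>) (f' \<beta>) = slice_metric (g q) \<alpha> \<beta>"
    using metric_preserving_derivative[OF assms(1) gq] by blast
  obtain g' where g': "(g has_derivative g') (at q)"
    "\<And>\<alpha> \<beta>. slice_metric (g q) (g' \<alpha>) (g' \<beta>) = slice_metric q \<alpha> \<beta>"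
    using metric_preserving_derivative[OF assms(2) q] by blast
  show "\<exists>h. ((\<lambda>q. f (g q)) has_derivative h) (at q) \<and>
      (\<forall>\<alpha> \<beta>. slice_metric (f (g q)) (h \<alpha>) (h \<beta>) = slice_metric q \<alpha> \<beta>)"
    using diff_chain_at[OF g'(1) f'(1)] f'(2) g'(2)
    by (intro exI[of _ "f' \<circ> g'"]) (simp add: o_def)
qed

text \<open>The metric involves products only through \<open>q p q\<close> and \<open>q q\<close>.
  Asking for compatibility with these covers automorphisms, the antiautomorphism \<open>qcnj\<close>
  and the sign change at once.\<close>

lemma metric_preserving_linear:
  assumes L: "bounded_linear L"
    and inner: "\<And>p q. L p \<bullet> L q = p \<bullet> q"
    and sandwich: "\<And>p q. L (q \<star>\<^sub>q p \<star>\<^sub>q q) = L q \<star>\<^sub>q L p \<star>\<^sub>q L q"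
    and square: "\<And>q. norm (qreal 1 - L q \<star>\<^sub>q L q) = norm (qreal 1 - q \<star>\<^sub>q q)"
  shows "metric_preserving L"
  unfolding metric_preserving_def
proof (intro ballI conjI)
  fix q assume q: "q \<in> qball"
  have norm: "norm (L p) = norm p" for p
    by (simp add: norm_eq_sqrt_inner inner)
  show "L q \<in> qball"
    using q by (simp add: qball_iff norm)
  have "L \<alpha> - L q \<star>\<^sub>q L \<alpha> \<star>\<^sub>q L q = L (\<alpha> - q \<star>\<^sub>q \<alpha> \<star>\<^sub>q q)" for \<alpha>
    by (simp add: sandwich linear_diff[OF bounded_linear.linear[OF L]])
  then show "\<exists>f'. (L has_derivative f') (at q) \<and>
      (\<forall>\<alpha> \<beta>. slice_metric (L q) (f' \<alpha>) (f' \<beta>) = slice_metric q \<alpha> \<beta>)"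
    using bounded_linear_imp_has_derivative[OF L]
    by (intro exI[of _ L]) (simp add: slice_metric_inner inner norm square)
qed

lemma restrict_has_derivative_iff:
  assumes "q \<in> qball"
  shows "(restrict f qball has_derivative f') (at q) \<longleftrightarrow> (f has_derivative f') (at q)"
proof
  assume "(restrict f qball has_derivative f') (at q)"
  from has_derivative_transform_within_open[OF this open_qball assms]
  show "(f has_derivative f') (at q)" by simp
next
  assume "(f has_derivative f') (at q)"
  from has_derivative_transform_within_open[OF this open_qball assms]
  show "(restrict f qball has_derivative f') (at q)" by simp
qed

text \<open>Since the ball is open, derivatives at its points do not see the restriction, so
  formulas for a map and its inverse on all of H suffice.\<close>

lemma slice_isometry_restrictI:
  assumes f: "metric_preserving f" and e: "metric_preserving e"
    and ef: "\<And>q. q \<in> qball \<Longrightarrow> e (f q) = q" and fe: "\<And>q. q \<in> qball \<Longrightarrow> f (e q) = q"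
  shows "slice_isometry (restrict f qball)"
proof -
  have bij: "bij_betw (restrict f qball) qball qball"
    using metric_preserving_in_qball[OF f] metric_preserving_in_qball[OF e] ef fe
    by (intro bij_betw_byWitness[of _ e]) auto
  have diff: "g differentiable_on qball"
    if h: "metric_preserving h" and gh: "\<And>q. q \<in> qball \<Longrightarrow> g q = h q" for g h
  proof -
    have "g differentiable (at q)" if q: "q \<in> qball" for q
    proof -
      obtain h' where h': "(h has_derivative h') (at q)"
        using metric_preserving_derivative[OF h q] .
      have "(g has_derivative h') (at q)"
        by (rule has_derivative_transform_within_open[OF h' open_qball q]) (simp add: gh)
      then show ?thesis
        by (auto simp: differentiable_def)
    qed
    then show ?thesis
      by (simp add: differentiable_at_imp_differentiable_on)
  qed
  have inv: "inv_into qball (restrict f qball) q = e q" if "q \<in> qball" for q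
    using metric_preserving_in_qball[OF e that] fe[OF that]
    by (intro inv_into_f_eq bij_betw_imp_inj_on[OF bij]) simp_all
  have "slice_metric (restrict f qball q) (f' \<alpha>) (f' \<beta>) = slice_metric q \<alpha> \<beta>"
    if q: "q \<in> qball" and "(restrict f qball has_derivative f') (at q)" for q f' \<alpha> \<beta>
  proof -
    obtain h' where h': "(f has_derivative h') (at q)"
      "\<And>\<alpha> \<beta>. slice_metric (f q) (h' \<alpha>) (h' \<beta>) = slice_metric q \<alpha> \<beta>"
      using metric_preserving_derivative[OF f q] by blast
    have "f' = h'"
      using that h'(1) by (simp add: restrict_has_derivative_iff has_derivative_unique)
    then show ?thesis
      using h'(2) q by simp
  qed
  then show ?thesis
    unfolding slice_isometry_def using bij diff[OF f] diff[OF e] inv by simp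
qed

text \<open>For the inverse, the chain rule on \<open>f (e q) = q\<close> shows that
  \<open>e'\<close> is a right inverse of \<open>f'\<close>; inserting \<open>e' \<alpha>\<close>
  and \<open>e' \<beta>\<close> into the identity for \<open>f\<close> gives the one for
  \<open>e\<close>.\<close>

lemma slice_isometry_metric_preserving:
  assumes "slice_isometry f"
  shows "metric_preserving f" "metric_preserving (inv_into qball f)"
proof -
  let ?e = "inv_into qball f"
  have bij: "bij_betw f qball qball" and f: "f differentiable_on qball"
    and e: "?e differentiable_on qball"
    and metric: "\<And>q f' \<alpha> \<beta>. q \<in> qball \<Longrightarrow> (f has_derivative f') (at q) \<Longrightarrow>
      slice_metric (f q) (f' \<alpha>) (f' \<beta>) = slice_metric q \<alpha> \<beta>"
    using assms by (auto simp: slice_isometry_def)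
  have df: "\<exists>f'. (f has_derivative f') (at q)" if "q \<in> qball" for q
    using f that open_qball by (auto simp: differentiable_on_eq_differentiable_at differentiable_def)
  have de: "\<exists>f'. (?e has_derivative f') (at q)" if "q \<in> qball" for q
    using e that open_qball by (auto simp: differentiable_on_eq_differentiable_at differentiable_def)
  show "metric_preserving f"
    unfolding metric_preserving_def using df metric bij_betwE[OF bij] by blast
  show "metric_preserving ?e"
    unfolding metric_preserving_def
  proof (intro ballI conjI)
    fix q assume q: "q \<in> qball"
    show eq: "?e q \<in> qball"
      using bij_betwE[OF bij_betw_inv_into[OF bij]] q by blast
    have feq: "f (?e p) = p" if "p \<in> qball" for p
      using bij that by (rule bij_betw_inv_into_right)
    obtain f' where f': "(f has_derivative f') (at (?e q))"
      using df[OF eq] by blast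
    obtain e' where e': "(?e has_derivative e') (at q)"
      using de[OF q] by blast
    have "((\<lambda>p. p) has_derivative f' \<circ> e') (at q)"
      using has_derivative_transform_within_open[OF diff_chain_at[OF e' f'] open_qball q] feq
      by simp
    then have "f' \<circ> e' = (\<lambda>p. p)"
      using has_derivative_unique has_derivative_ident by blast
    then have "f' (e' \<alpha>) = \<alpha>" for \<alpha>
      by (metis comp_apply)
    then have "slice_metric (?e q) (e' \<alpha>) (e' \<beta>) = slice_metric q \<alpha> \<beta>" for \<alpha> \<beta>
      using metric[OF eq f', of "e' \<alpha>" "e' \<beta>"] feq[OF q] by simp
    then show "\<exists>g'. (?e has_derivative g') (at q) \<and>
        (\<forall>\<alpha> \<beta>. slice_metric (?e q) (g' \<alpha>) (g' \<beta>) = slice_metric q \<alpha> \<beta>)"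
      using e' by blast
  qed
qed

lemma slice_isometry_inverse:
  assumes "slice_isometry f" "q \<in> qball"
  shows "inv_into qball f (f q) = q" "f (inv_into qball f q) = q"
proof -
  have "bij_betw f qball qball"
    using assms(1) by (simp add: slice_isometry_def)
  then show "inv_into qball f (f q) = q" "f (inv_into qball f q) = q"
    using assms(2) by (auto simp: bij_betw_inv_into_left bij_betw_inv_into_right)
qed

section \<open>The group action by isometries\<close>

text \<open>The parameter is the value of tanh, that is, the image of 0. The coefficients are real,
  so every slice is mapped to itself.\<close>

definition qmoebius :: "real \<Rightarrow> quat \<Rightarrow> quat" where
  "qmoebius t q = qinv (qreal 1 + t *\<^sub>R q) \<star>\<^sub>q (q + qreal t)"

definition qrotate :: "quat \<Rightarrow> quat \<Rightarrow> quat" where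
  "qrotate u q = u \<star>\<^sub>q q \<star>\<^sub>q qcnj u"

text \<open>Every \<open>e\<close> other than 1 means conjugation, matching the case distinction in
  \<open>grp_act\<close>.\<close>

definition qflip :: "real \<Rightarrow> quat \<Rightarrow> quat" where
  "qflip e q = (if e = 1 then q else qcnj q)"

lemma grp_act_decompose:
  "grp_act (u, (e1, t), e2) q = e1 *\<^sub>R qrotate u (qmoebius (tanh t) (qflip e2 q))"
  by (simp add: grp_act_def qrotate_def qmoebius_def qflip_def qmult_assoc)

lemma qreal_eq_scaleR: "qreal r = r *\<^sub>R qreal 1"
  by (simp add: qreal_def)

section \<open>Real Moebius transformations\<close>

lemma moebius_denom_nonzero:
  assumes "\<bar>t\<bar> < 1" "q \<in> qball"
  shows "qreal 1 + t *\<^sub>R q \<noteq> 0"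
proof
  assume "qreal 1 + t *\<^sub>R q = 0"
  then have "qreal 1 = - (t *\<^sub>R q)"
    by (simp add: eq_neg_iff_add_eq_0)
  then have "norm (qreal 1) = \<bar>t\<bar> * norm q"
    by (metis norm_minus_cancel norm_scaleR)
  then show False
    using assms mult_strict_mono[of "\<bar>t\<bar>" 1 "norm q" 1] by (simp add: qball_iff)
qed

lemma qmoebius_mult:
  assumes "\<bar>t\<bar> < 1" "q \<in> qball"
  shows "(qreal 1 + t *\<^sub>R q) \<star>\<^sub>q qmoebius t q = q + qreal t"
  using qinv_right[OF moebius_denom_nonzero[OF assms]]
  by (simp add: qmoebius_def flip: qmult_assoc)

text \<open>This inverse-free characterization lets the identities below be proved by applying an
  algebraic operation to the defining equation.\<close>

lemma qmoebius_unique: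
  assumes "\<bar>t\<bar> < 1" "q \<in> qball" "(qreal 1 + t *\<^sub>R q) \<star>\<^sub>q p = q + qreal t"
  shows "p = qmoebius t q"
  using assms qmoebius_mult[OF assms(1,2)] qmult_left_cancel[OF moebius_denom_nonzero[OF assms(1,2)]]
  by metis

text \<open>Left and right quotients agree because numerator and denominator both lie in the
  commutative algebra generated by \<open>q\<close>.\<close>

lemma qmoebius_right: "qmoebius t q = (q + qreal t) \<star>\<^sub>q qinv (qreal 1 + t *\<^sub>R q)"
  unfolding qmoebius_def qinv_def qmult.scaleR_left qmult.scaleR_right
  by (rule arg_cong[where f = "scaleR _"], cases q)
    (simp add: qmult_def qcnj_def qreal_def algebra_simps)

lemma norm_moebius_identity:
  "(norm (qreal 1 + t *\<^sub>R q))\<^sup>2 - (norm (q + qreal t))\<^sup>2 = (1 - t\<^sup>2) * (1 - (norm q)\<^sup>2)"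
  unfolding power2_norm_eq_inner
  by (cases q) (simp add: qreal_def power2_eq_square algebra_simps)

lemma one_minus_norm_qmoebius:
  assumes "\<bar>t\<bar> < 1" "q \<in> qball"
  shows "1 - (norm (qmoebius t q))\<^sup>2 = (1 - t\<^sup>2) * (1 - (norm q)\<^sup>2) / (norm (qreal 1 + t *\<^sub>R q))\<^sup>2"
proof -
  define a where "a = norm (qreal 1 + t *\<^sub>R q)"
  have a: "a > 0"
    using moebius_denom_nonzero[OF assms] by (simp add: a_def)
  have "norm (qmoebius t q) = norm (q + qreal t) / a"
    by (simp add: qmoebius_def norm_qmult norm_qinv a_def)
  then have "1 - (norm (qmoebius t q))\<^sup>2 = (a\<^sup>2 - (norm (q + qreal t))\<^sup>2) / a\<^sup>2"
    using a by (simp add: power_divide diff_divide_distrib)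
  then show ?thesis
    using norm_moebius_identity[of t q] by (simp add: a_def)
qed

lemma qmoebius_in_qball:
  assumes "\<bar>t\<bar> < 1" "q \<in> qball"
  shows "qmoebius t q \<in> qball"
proof -
  have "0 < (1 - t\<^sup>2) * (1 - (norm q)\<^sup>2) / (norm (qreal 1 + t *\<^sub>R q))\<^sup>2"
    using assms moebius_denom_nonzero[OF assms] qball_norm_power2[OF assms(2)]
    by (simp add: abs_square_less_1)
  then have "(norm (qmoebius t q))\<^sup>2 < 1"
    using one_minus_norm_qmoebius[OF assms] by linarith
  then show ?thesis
    by (simp add: qball_iff abs_square_less_1)
qed

lemma qmoebius_differentiable:
  assumes "\<bar>t\<bar> < 1" "q \<in> qball"
  shows "qmoebius t differentiable (at q)"
proof -
  have eq: "qmoebius t = (\<lambda>q. inverse ((qreal 1 + t *\<^sub>R q) \<bullet> (qreal 1 + t *\<^sub>R q)) *\<^sub>R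
      (qcnj (qreal 1 + t *\<^sub>R q) \<star>\<^sub>q (q + qreal t)))"
    by (simp add: fun_eq_iff qmoebius_def qinv_def qmult.scaleR_left power2_norm_eq_inner
        inverse_eq_divide)
  have "(\<lambda>q. qcnj (qreal 1 + t *\<^sub>R q) \<star>\<^sub>q (q + qreal t)) differentiable (at q)"
    unfolding differentiable_def
    by (rule exI, rule qmult.FDERIV)
      (auto intro!: derivative_eq_intros bounded_linear.has_derivative[OF bounded_linear_qcnj])
  then show ?thesis
    using moebius_denom_nonzero[OF assms] unfolding eq
    by (intro differentiable_scaleR differentiable_inverse) (auto intro!: derivative_intros)
qed

text \<open>Once differentiability is known, the product rule on (1 + t q) M(q) = q + t gives a
  D(\<alpha>) = \<alpha> (1 - t M(q)) with a = 1 + t q. The last factor is (1 - t^2) times the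
  inverse of a, because (1 - t M(q)) a = a - t (q + t).\<close>

lemma qmoebius_has_derivative:
  assumes t: "\<bar>t\<bar> < 1" and q: "q \<in> qball"
  shows "(qmoebius t has_derivative
    (\<lambda>\<alpha>. (1 - t\<^sup>2) *\<^sub>R (qinv (qreal 1 + t *\<^sub>R q) \<star>\<^sub>q \<alpha> \<star>\<^sub>q qinv (qreal 1 + t *\<^sub>R q)))) (at q)"
proof -
  define a where "a = qreal 1 + t *\<^sub>R q"
  have a: "a \<noteq> 0"
    using moebius_denom_nonzero[OF t q] by (simp add: a_def)
  obtain D where D: "(qmoebius t has_derivative D) (at q)"
    using qmoebius_differentiable[OF t q] by (auto simp: differentiable_def)
  have "((\<lambda>q. (qreal 1 + t *\<^sub>R q) \<star>\<^sub>q qmoebius t q) has_derivative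
      (\<lambda>\<alpha>. a \<star>\<^sub>q D \<alpha> + (t *\<^sub>R \<alpha>) \<star>\<^sub>q qmoebius t q)) (at q)"
    unfolding a_def by (rule qmult.FDERIV) (auto intro!: derivative_eq_intros D)
  then have "((\<lambda>q. q + qreal t) has_derivative
      (\<lambda>\<alpha>. a \<star>\<^sub>q D \<alpha> + (t *\<^sub>R \<alpha>) \<star>\<^sub>q qmoebius t q)) (at q)"
    by (rule has_derivative_transform_within_open[OF _ open_qball q]) (rule qmoebius_mult[OF t])
  moreover have "((\<lambda>q. q + qreal t) has_derivative (\<lambda>\<alpha>. \<alpha>)) (at q)"
    by (auto intro!: derivative_eq_intros)
  ultimately have "(\<lambda>\<alpha>. a \<star>\<^sub>q D \<alpha> + (t *\<^sub>R \<alpha>) \<star>\<^sub>q qmoebius t q) = (\<lambda>\<alpha>. \<alpha>)"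
    by (rule has_derivative_unique)
  then have aD: "a \<star>\<^sub>q D \<alpha> + (t *\<^sub>R \<alpha>) \<star>\<^sub>q qmoebius t q = \<alpha>" for \<alpha>
    by meson
  have "(qreal 1 - t *\<^sub>R qmoebius t q) \<star>\<^sub>q a = a - t *\<^sub>R (q + qreal t)"
    using qinv_left[OF a]
    by (simp add: qmoebius_right qmult.diff_left qmult.scaleR_left qmult_assoc a_def)
  also have "\<dots> = (1 - t\<^sup>2) *\<^sub>R qreal 1"
    by (cases q) (simp add: a_def qreal_def power2_eq_square zero_prod_def algebra_simps)
  finally have "(qreal 1 - t *\<^sub>R qmoebius t q) \<star>\<^sub>q a \<star>\<^sub>q qinv a = (1 - t\<^sup>2) *\<^sub>R qreal 1 \<star>\<^sub>q qinv a"
    by simp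
  then have one_minus: "qreal 1 - t *\<^sub>R qmoebius t q = (1 - t\<^sup>2) *\<^sub>R qinv a"
    using qinv_right[OF a] by (simp add: qmult_assoc qmult.scaleR_left)
  have "D \<alpha> = (1 - t\<^sup>2) *\<^sub>R (qinv a \<star>\<^sub>q \<alpha> \<star>\<^sub>q qinv a)" for \<alpha>
  proof -
    have "a \<star>\<^sub>q D \<alpha> = \<alpha> \<star>\<^sub>q (qreal 1 - t *\<^sub>R qmoebius t q)"
      using aD[of \<alpha>] by (simp add: qmult.diff_right qmult.scaleR_right qmult.scaleR_left algebra_simps)
    then have "qinv a \<star>\<^sub>q a \<star>\<^sub>q D \<alpha> = (1 - t\<^sup>2) *\<^sub>R (qinv a \<star>\<^sub>q \<alpha> \<star>\<^sub>q qinv a)"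
      by (simp add: one_minus qmult_assoc qmult.scaleR_right)
    then show ?thesis
      by (simp add: qinv_left[OF a])
  qed
  then have "D = (\<lambda>\<alpha>. (1 - t\<^sup>2) *\<^sub>R (qinv a \<star>\<^sub>q \<alpha> \<star>\<^sub>q qinv a))"
    by (rule ext)
  then show ?thesis
    using D unfolding a_def by blast
qed

text \<open>Each ingredient of the metric is scaled: \<open>\<alpha> - q \<alpha> q\<close> turns
  into \<open>s^2 c^2 (\<alpha> - q \<alpha> q) c^2\<close> with |c| = 1 / N, while |1 - q^2| and 1
  - |q|^2 are both multiplied by s / N^2. Numerator and denominator thus acquire the same factor s^4
  / N^8.\<close>

lemma metric_preserving_qmoebius:
  assumes t: "\<bar>t\<bar> < 1"
  shows "metric_preserving (qmoebius t)"
  unfolding metric_preserving_def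
proof (intro ballI conjI)
  fix q assume q: "q \<in> qball"
  show p_ball: "qmoebius t q \<in> qball"
    by (rule qmoebius_in_qball[OF t q])
  define a where "a = qreal 1 + t *\<^sub>R q"
  define c where "c = qinv a"
  define p where "p = qmoebius t q"
  define s where "s = 1 - t\<^sup>2"
  define N where "N = norm a"
  have a: "a \<noteq> 0"
    using moebius_denom_nonzero[OF t q] by (simp add: a_def)
  then have N: "N > 0"
    by (simp add: N_def)
  have s: "s > 0"
    using t by (simp add: s_def abs_square_less_1)
  have norm_c: "norm c = 1 / N"
    by (simp add: c_def norm_qinv N_def)
  have ca: "c \<star>\<^sub>q a = qreal 1" "a \<star>\<^sub>q c = qreal 1"
    by (simp_all add: c_def qinv_left[OF a] qinv_right[OF a])
  have p: "p = c \<star>\<^sub>q (q + qreal t)" "p = (q + qreal t) \<star>\<^sub>q c"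
    unfolding p_def c_def a_def by (rule qmoebius_def, rule qmoebius_right)
  \<comment> \<open>The core is a \<alpha> a - (q + t) \<alpha> (q + t) = s (\<alpha> - q \<alpha>
    q), where the mixed terms t (q \<alpha> + \<alpha> q) cancel. Multiplication by
    \<open>c c\<close> on both sides turns the left-hand side into c \<alpha> c - p (c \<alpha> c)
    p, using both quotient forms of \<open>p\<close>.\<close>
  have key: "s *\<^sub>R (c \<star>\<^sub>q \<alpha> \<star>\<^sub>q c) - p \<star>\<^sub>q (s *\<^sub>R (c \<star>\<^sub>q \<alpha> \<star>\<^sub>q c)) \<star>\<^sub>q p =
      s\<^sup>2 *\<^sub>R ((c \<star>\<^sub>q c) \<star>\<^sub>q (\<alpha> - q \<star>\<^sub>q \<alpha> \<star>\<^sub>q q) \<star>\<^sub>q (c \<star>\<^sub>q c))" for \<alpha>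
  proof -
    have "a \<star>\<^sub>q \<alpha> \<star>\<^sub>q a - (q + qreal t) \<star>\<^sub>q \<alpha> \<star>\<^sub>q (q + qreal t) = s *\<^sub>R (\<alpha> - q \<star>\<^sub>q \<alpha> \<star>\<^sub>q q)"
      by (simp add: a_def s_def qmult.add_left qmult.add_right qmult.scaleR_left qmult.scaleR_right
          power2_eq_square algebra_simps)
    then have "(c \<star>\<^sub>q c) \<star>\<^sub>q (a \<star>\<^sub>q \<alpha> \<star>\<^sub>q a - (q + qreal t) \<star>\<^sub>q \<alpha> \<star>\<^sub>q (q + qreal t)) \<star>\<^sub>q (c \<star>\<^sub>q c) =
        s *\<^sub>R ((c \<star>\<^sub>q c) \<star>\<^sub>q (\<alpha> - q \<star>\<^sub>q \<alpha> \<star>\<^sub>q q) \<star>\<^sub>q (c \<star>\<^sub>q c))"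
      by (simp add: qmult.scaleR_left qmult.scaleR_right)
    moreover have "(c \<star>\<^sub>q c) \<star>\<^sub>q (a \<star>\<^sub>q \<alpha> \<star>\<^sub>q a) \<star>\<^sub>q (c \<star>\<^sub>q c) = c \<star>\<^sub>q \<alpha> \<star>\<^sub>q c"
      by (metis ca qmult_assoc qmult_qreal scaleR_one)
    moreover have "(c \<star>\<^sub>q c) \<star>\<^sub>q ((q + qreal t) \<star>\<^sub>q \<alpha> \<star>\<^sub>q (q + qreal t)) \<star>\<^sub>q (c \<star>\<^sub>q c) =
        p \<star>\<^sub>q (c \<star>\<^sub>q \<alpha> \<star>\<^sub>q c) \<star>\<^sub>q p"
      using p by (metis qmult_assoc)
    ultimately have "c \<star>\<^sub>q \<alpha> \<star>\<^sub>q c - p \<star>\<^sub>q (c \<star>\<^sub>q \<alpha> \<star>\<^sub>q c) \<star>\<^sub>q p =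
        s *\<^sub>R ((c \<star>\<^sub>q c) \<star>\<^sub>q (\<alpha> - q \<star>\<^sub>q \<alpha> \<star>\<^sub>q q) \<star>\<^sub>q (c \<star>\<^sub>q c))"
      by (simp only: qmult.diff_left qmult.diff_right)
    then show ?thesis
      by (simp only: qmult.scaleR_left qmult.scaleR_right power2_eq_square flip: scaleR_scaleR
          scaleR_diff_right)
  qed
  have "a \<star>\<^sub>q a - (q + qreal t) \<star>\<^sub>q (q + qreal t) = s *\<^sub>R (qreal 1 - q \<star>\<^sub>q q)"
    by (cases q) (simp add: a_def s_def qmult_def qreal_def power2_eq_square algebra_simps)
  then have "c \<star>\<^sub>q (a \<star>\<^sub>q a - (q + qreal t) \<star>\<^sub>q (q + qreal t)) \<star>\<^sub>q c =
      s *\<^sub>R (c \<star>\<^sub>q (qreal 1 - q \<star>\<^sub>q q) \<star>\<^sub>q c)"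
    by (simp add: qmult.scaleR_left qmult.scaleR_right)
  moreover have "c \<star>\<^sub>q (a \<star>\<^sub>q a) \<star>\<^sub>q c = qreal 1"
    by (metis ca qmult_assoc qmult_qreal scaleR_one)
  moreover have "c \<star>\<^sub>q ((q + qreal t) \<star>\<^sub>q (q + qreal t)) \<star>\<^sub>q c = p \<star>\<^sub>q p"
    using p by (metis qmult_assoc)
  ultimately have "qreal 1 - p \<star>\<^sub>q p = s *\<^sub>R (c \<star>\<^sub>q (qreal 1 - q \<star>\<^sub>q q) \<star>\<^sub>q c)"
    by (simp only: qmult.diff_left qmult.diff_right)
  then have sq: "norm (qreal 1 - p \<star>\<^sub>q p) = s * norm (qreal 1 - q \<star>\<^sub>q q) / N\<^sup>2"
    using s by (simp add: norm_qmult norm_c power2_eq_square)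
  have np: "1 - (norm p)\<^sup>2 = s * (1 - (norm q)\<^sup>2) / N\<^sup>2"
    using one_minus_norm_qmoebius[OF t q] by (simp add: p_def s_def N_def a_def)
  have "slice_metric p (s *\<^sub>R (c \<star>\<^sub>q \<alpha> \<star>\<^sub>q c)) (s *\<^sub>R (c \<star>\<^sub>q \<beta> \<star>\<^sub>q c)) = slice_metric q \<alpha> \<beta>" for \<alpha> \<beta>
    unfolding slice_metric_inner key sq np
    using s N by (simp add: qmult_inner_left qmult_inner_right norm_qmult norm_c power_mult_distrib
        power_divide power2_eq_square)
  then show "\<exists>f'. (qmoebius t has_derivative f') (at q) \<and>
      (\<forall>\<alpha> \<beta>. slice_metric (qmoebius t q) (f' \<alpha>) (f' \<beta>) = slice_metric q \<alpha> \<beta>)"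
    using qmoebius_has_derivative[OF t q] unfolding p_def c_def a_def s_def by blast
qed

lemma qreal_one_mult [simp]: "qreal 1 \<star>\<^sub>q q = q" "q \<star>\<^sub>q qreal 1 = q"
  by simp_all

text \<open>By the addition theorem of tanh, multiplying the denominator and numerator of the outer
  map by the inner denominator \<open>b\<close> produces 1 + \<sigma> \<tau> times those of the map
  with parameter \<open>s + t\<close>. Cancelling \<open>b\<close> shows that \<open>z\<close>
  solves the defining equation of the composition.\<close>

lemma qmoebius_add:
  assumes "q \<in> qball"
  shows "qmoebius (tanh s) (qmoebius (tanh t) q) = qmoebius (tanh (s + t)) q"
proof -
  define \<sigma> \<tau> where "\<sigma> = tanh s" and "\<tau> = tanh t"
  have \<sigma>: "\<bar>\<sigma>\<bar> < 1" and \<tau>: "\<bar>\<tau>\<bar> < 1"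
    using tanh_real_bounds[of s] tanh_real_bounds[of t] by (auto simp: \<sigma>_def \<tau>_def)
  have st: "\<bar>tanh (s + t)\<bar> < 1"
    using tanh_real_bounds[of "s + t"] by auto
  have "\<bar>\<sigma> * \<tau>\<bar> < 1"
    using mult_strict_mono'[OF \<sigma> \<tau>] by (simp add: abs_mult)
  then have k: "1 + \<sigma> * \<tau> > 0"
    by (simp add: abs_less_iff)
  have sum: "(1 + \<sigma> * \<tau>) * tanh (s + t) = \<sigma> + \<tau>"
    using k by (simp add: tanh_add \<sigma>_def \<tau>_def)
  define b y z where "b = qreal 1 + \<tau> *\<^sub>R q" and "y = qmoebius \<tau> q" and "z = qmoebius (tanh (s + t)) q"
  have b: "b \<noteq> 0"
    using moebius_denom_nonzero[OF \<tau> assms] by (simp add: b_def)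
  have y: "b \<star>\<^sub>q y = q + qreal \<tau>"
    using qmoebius_mult[OF \<tau> assms] by (simp add: b_def y_def)
  have z: "(qreal 1 + tanh (s + t) *\<^sub>R q) \<star>\<^sub>q z = q + qreal (tanh (s + t))"
    using qmoebius_mult[OF st assms] by (simp add: z_def)
  have "b \<star>\<^sub>q (qreal 1 + \<sigma> *\<^sub>R y) = b + \<sigma> *\<^sub>R (q + qreal \<tau>)"
    by (simp add: qmult.add_right qmult.scaleR_right y)
  also have "\<dots> = (1 + \<sigma> * \<tau>) *\<^sub>R (qreal 1 + tanh (s + t) *\<^sub>R q)"
    unfolding scaleR_add_right scaleR_scaleR sum
    by (cases q) (simp add: b_def qreal_def zero_prod_def algebra_simps)
  finally have "b \<star>\<^sub>q ((qreal 1 + \<sigma> *\<^sub>R y) \<star>\<^sub>q z) = (1 + \<sigma> * \<tau>) *\<^sub>R (q + qreal (tanh (s + t)))"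
    using z by (simp add: qmult.scaleR_left flip: qmult_assoc)
  also have "\<dots> = b \<star>\<^sub>q (y + qreal \<sigma>)"
    unfolding qmult.add_right y scaleR_add_right qreal_eq_scaleR[of "tanh (s + t)"] scaleR_scaleR sum
    unfolding qmult_qreal
    by (cases q) (simp add: b_def qreal_def zero_prod_def algebra_simps)
  finally have "(qreal 1 + \<sigma> *\<^sub>R y) \<star>\<^sub>q z = y + qreal \<sigma>"
    using b by (simp add: qmult_left_cancel)
  then show ?thesis
    using qmoebius_unique[OF \<sigma>, of y z] qmoebius_in_qball[OF \<tau> assms]
    by (simp add: y_def z_def \<sigma>_def \<tau>_def)
qed

lemma qmoebius_zero [simp]: "qmoebius 0 q = q"
  by (simp add: qmoebius_def qinv_def) (simp add: qreal_def flip: zero_prod_def)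

text \<open>Conjugation by the sign change inverts the translation; this is the twist in the
  semidirect product.\<close>

lemma qmoebius_uminus: "qmoebius (- t) (- q) = - qmoebius t q"
proof -
  have "- q + qreal (- t) = - (q + qreal t)"
    by (simp add: qreal_def)
  then show ?thesis
    by (simp only: qmoebius_def qmult.minus_right scaleR_minus_left scaleR_minus_right minus_minus)
qed

text \<open>Conjugation reverses products, so it exchanges the right quotient with the left
  one.\<close>

lemma qmoebius_qcnj:
  assumes "\<bar>t\<bar> < 1" "q \<in> qball"
  shows "qmoebius t (qcnj q) = qcnj (qmoebius t q)"
proof -
  have cnj: "qcnj (q + qreal t) = qcnj q + qreal t" "qcnj (qreal 1 + t *\<^sub>R q) = qreal 1 + t *\<^sub>R qcnj q" for q
    by (simp_all add: linear_add[OF linear_qcnj] linear_scale[OF linear_qcnj])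
  have "qcnj (qinv p) = qinv (qcnj p)" for p
    by (simp add: qinv_def linear_scale[OF linear_qcnj])
  then show ?thesis
    by (simp only: qmoebius_right[of t q] qmoebius_def[of t "qcnj q"] qcnj_qmult cnj)
qed

section \<open>Rotations, conjugation and sign change\<close>

lemma Sp1_qcnj: "u \<in> Sp1 \<Longrightarrow> u \<star>\<^sub>q qcnj u = qreal 1" "u \<in> Sp1 \<Longrightarrow> qcnj u \<star>\<^sub>q u = qreal 1"
  by (simp_all add: Sp1_def qmult_qcnj)

lemma Sp1_closed: "u \<in> Sp1 \<Longrightarrow> v \<in> Sp1 \<Longrightarrow> u \<star>\<^sub>q v \<in> Sp1" "u \<in> Sp1 \<Longrightarrow> qcnj u \<in> Sp1"
  by (simp_all add: Sp1_def norm_qmult)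

lemma norm_qrotate: "u \<in> Sp1 \<Longrightarrow> norm (qrotate u q) = norm q"
  by (simp add: qrotate_def norm_qmult Sp1_def)

lemma qrotate_qmult:
  assumes "u \<in> Sp1"
  shows "qrotate u (p \<star>\<^sub>q q) = qrotate u p \<star>\<^sub>q qrotate u q"
proof -
  have "qcnj u \<star>\<^sub>q (u \<star>\<^sub>q r) = r" for r
    by (simp add: Sp1_qcnj[OF assms] flip: qmult_assoc)
  then show ?thesis
    by (simp add: qrotate_def qmult_assoc)
qed

lemma bounded_linear_qrotate: "bounded_linear (qrotate u)"
  unfolding qrotate_def
  by (intro bounded_linear_compose[OF qmult.bounded_linear_left] qmult.bounded_linear_right)

lemmas linear_qrotate = bounded_linear.linear[OF bounded_linear_qrotate]

lemma qrotate_qreal: "u \<in> Sp1 \<Longrightarrow> qrotate u (qreal r) = qreal r"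
  unfolding qrotate_def qmult_qreal qmult.scaleR_left by (simp add: Sp1_qcnj flip: qreal_eq_scaleR)

lemma qrotate_qrotate: "qrotate u (qrotate v q) = qrotate (u \<star>\<^sub>q v) q"
  by (simp add: qrotate_def qcnj_qmult qmult_assoc)

lemma qrotate_qcnj: "qrotate u (qcnj q) = qcnj (qrotate u q)"
  by (simp add: qrotate_def qcnj_qmult qmult_assoc)

lemma qmoebius_qrotate:
  assumes "\<bar>t\<bar> < 1" "q \<in> qball" "u \<in> Sp1"
  shows "qmoebius t (qrotate u q) = qrotate u (qmoebius t q)"
proof -
  have "qrotate u ((qreal 1 + t *\<^sub>R q) \<star>\<^sub>q qmoebius t q) = qrotate u (q + qreal t)"
    using assms qmoebius_mult by simp
  then have "(qreal 1 + t *\<^sub>R qrotate u q) \<star>\<^sub>q qrotate u (qmoebius t q) = qrotate u q + qreal t"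
    by (simp only: qrotate_qmult[OF assms(3)] linear_add[OF linear_qrotate]
        linear_scale[OF linear_qrotate] qrotate_qreal[OF assms(3)])
  then show ?thesis
    using qmoebius_unique[of t "qrotate u q"] assms norm_qrotate by (simp add: qball_iff)
qed

lemma metric_preserving_qrotate:
  assumes "u \<in> Sp1"
  shows "metric_preserving (qrotate u)"
proof (rule metric_preserving_linear[OF bounded_linear_qrotate])
  show "qrotate u p \<bullet> qrotate u q = p \<bullet> q" for p q
    using assms by (simp add: qrotate_def qmult_inner_left qmult_inner_right Sp1_def)
  have "qreal 1 - qrotate u q \<star>\<^sub>q qrotate u q = qrotate u (qreal 1 - q \<star>\<^sub>q q)" for q
    by (simp add: linear_diff[OF linear_qrotate] qrotate_qmult[OF assms] qrotate_qreal[OF assms])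
  then show "norm (qreal 1 - qrotate u q \<star>\<^sub>q qrotate u q) = norm (qreal 1 - q \<star>\<^sub>q q)" for q
    by (simp add: norm_qrotate[OF assms])
qed (simp add: qrotate_qmult[OF assms])

lemma metric_preserving_qcnj: "metric_preserving qcnj"
proof (rule metric_preserving_linear[OF bounded_linear_qcnj])
  have "qreal 1 - qcnj q \<star>\<^sub>q qcnj q = qcnj (qreal 1 - q \<star>\<^sub>q q)" for q
    by (simp add: linear_diff[OF linear_qcnj] qcnj_qmult)
  then show "norm (qreal 1 - qcnj q \<star>\<^sub>q qcnj q) = norm (qreal 1 - q \<star>\<^sub>q q)" for q
    by simp
qed (simp_all add: qcnj_inner qcnj_qmult qmult_assoc)

lemma metric_preserving_scaleR:
  assumes "e \<in> {1, -1 :: real}"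
  shows "metric_preserving (scaleR e)"
proof (rule metric_preserving_linear[OF bounded_linear_scaleR_right])
  have ee: "e * e = 1"
    using assms by auto
  then show "e *\<^sub>R p \<bullet> e *\<^sub>R q = p \<bullet> q" for p q :: quat
    by (simp flip: mult.assoc)
  show "e *\<^sub>R (q \<star>\<^sub>q p \<star>\<^sub>q q) = e *\<^sub>R q \<star>\<^sub>q e *\<^sub>R p \<star>\<^sub>q e *\<^sub>R q" for p q
    using ee by (simp add: qmult.scaleR_left qmult.scaleR_right)
  show "norm (qreal 1 - e *\<^sub>R q \<star>\<^sub>q e *\<^sub>R q) = norm (qreal 1 - q \<star>\<^sub>q q)" for q
    using ee by (simp add: qmult.scaleR_left qmult.scaleR_right)
qed

lemma metric_preserving_qflip: "metric_preserving (qflip e)"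
proof (cases "e = 1")
  case True
  have "metric_preserving (scaleR 1)"
    by (rule metric_preserving_scaleR) simp
  moreover have "qflip e = scaleR 1"
    using True by (simp add: qflip_def fun_eq_iff)
  ultimately show ?thesis
    by simp
qed (simp add: qflip_def[abs_def] metric_preserving_qcnj)

section \<open>The group acts by isometries\<close>

lemma tanh_abs_lt_1: "\<bar>tanh (t :: real)\<bar> < 1"
  using tanh_real_bounds[of t] by auto

lemma metric_preserving_grp_act:
  assumes "g \<in> grp_carrier"
  shows "metric_preserving (grp_act g)"
proof -
  obtain u e1 t e2 where g: "g = (u, (e1, t), e2)" "u \<in> Sp1" "e1 \<in> {1, -1}"
    using assms by (auto simp: grp_carrier_def)
  have "grp_act g = (\<lambda>q. e1 *\<^sub>R qrotate u (qmoebius (tanh t) (qflip e2 q)))"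
    unfolding g by (rule ext) (rule grp_act_decompose)
  moreover have "metric_preserving (\<lambda>q. e1 *\<^sub>R qrotate u (qmoebius (tanh t) (qflip e2 q)))"
    by (intro metric_preserving_comp[OF metric_preserving_scaleR[OF g(3)]]
        metric_preserving_comp[OF metric_preserving_qrotate[OF g(2)]]
        metric_preserving_comp[OF metric_preserving_qmoebius[OF tanh_abs_lt_1]]
        metric_preserving_qflip)
  ultimately show ?thesis
    by simp
qed

lemma grp_act_in_qball: "g \<in> grp_carrier \<Longrightarrow> q \<in> qball \<Longrightarrow> grp_act g q \<in> qball"
  by (rule metric_preserving_in_qball[OF metric_preserving_grp_act])

lemma grp_act_one: "grp_act grp_one q = q"
  by (simp add: grp_one_def grp_act_decompose qrotate_def qflip_def)

text \<open>The outer conjugation is moved inwards past sign, rotation and translation, all of which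
  commute with it. The inner sign then passes the outer translation and turns \<open>s\<close> into
  \<open>c * s\<close>, and the inner rotation passes it unchanged; finally like factors are
  merged.\<close>

lemma grp_act_mult:
  assumes "g \<in> grp_carrier" "h \<in> grp_carrier" "q \<in> qball"
  shows "grp_act (grp_mult g h) q = grp_act g (grp_act h q)"
proof -
  obtain u a s b where g: "g = (u, (a, s), b)" "u \<in> Sp1" "a \<in> {1, -1}" "b \<in> {1, -1}"
    using assms(1) by (auto simp: grp_carrier_def)
  obtain v c t d where h: "h = (v, (c, t), d)" "v \<in> Sp1" "c \<in> {1, -1}" "d \<in> {1, -1}"
    using assms(2) by (auto simp: grp_carrier_def)
  define p where "p = qflip d q"
  have p: "p \<in> qball"
    using assms(3) by (simp add: p_def qflip_def qball_iff)
  define m where "m = qmoebius (tanh t) (qflip b p)"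
  have bp: "qflip b p \<in> qball"
    using p by (simp add: qflip_def qball_iff)
  have m: "m \<in> qball"
    unfolding m_def by (rule qmoebius_in_qball[OF tanh_abs_lt_1 bp])
  have flip: "qflip b (c *\<^sub>R qrotate v (qmoebius (tanh t) p)) = c *\<^sub>R qrotate v m"
    using qmoebius_qcnj[OF tanh_abs_lt_1 p]
    by (auto simp: qflip_def m_def linear_scale[OF linear_qcnj] qrotate_qcnj)
  have vm: "qrotate v m \<in> qball"
    using m norm_qrotate[OF h(2)] by (simp add: qball_iff)
  have sign: "qmoebius (tanh s) (c *\<^sub>R r) = c *\<^sub>R qmoebius (tanh (c * s)) r" for r
    using h(3) qmoebius_uminus[of "tanh (- s)" r] by auto
  have "grp_act g (grp_act h q) = a *\<^sub>R qrotate u (qmoebius (tanh s) (c *\<^sub>R qrotate v m))"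
    unfolding g h grp_act_decompose p_def[symmetric] flip ..
  also have "\<dots> = (a * c) *\<^sub>R qrotate u (qrotate v (qmoebius (tanh (c * s)) m))"
    unfolding sign qmoebius_qrotate[OF tanh_abs_lt_1 m h(2)] linear_scale[OF linear_qrotate]
    by simp
  also have "\<dots> = (a * c) *\<^sub>R qrotate (u \<star>\<^sub>q v) (qmoebius (tanh (c * s + t)) (qflip b p))"
    unfolding m_def qmoebius_add[OF bp] qrotate_qrotate ..
  also have "qflip b p = qflip (b * d) q"
    using g(4) h(4) by (auto simp: p_def qflip_def)
  finally show ?thesis
    by (simp add: g h grp_mult_def grp_act_decompose)
qed

lemma grp_mult_closed:
  assumes "g \<in> grp_carrier" "h \<in> grp_carrier"
  shows "grp_mult g h \<in> grp_carrier"
proof -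
  obtain u a s b where g: "g = (u, (a, s), b)" "u \<in> Sp1" "a \<in> {1, -1}" "b \<in> {1, -1}"
    using assms(1) by (auto simp: grp_carrier_def)
  obtain v c t d where h: "h = (v, (c, t), d)" "v \<in> Sp1" "c \<in> {1, -1}" "d \<in> {1, -1}"
    using assms(2) by (auto simp: grp_carrier_def)
  have "(u \<star>\<^sub>q v, (a * c, c * s + t), b * d) \<in> grp_carrier"
    using Sp1_closed(1)[OF g(2) h(2)] g(3,4) h(3,4) by (auto simp: grp_carrier_def)
  then show ?thesis
    by (simp add: g h grp_mult_def)
qed

lemma grp_inverse_exists:
  assumes "g \<in> grp_carrier"
  obtains h where "h \<in> grp_carrier" "grp_mult g h = grp_one" "grp_mult h g = grp_one"
proof -
  obtain u a s b where g: "g = (u, (a, s), b)" "u \<in> Sp1" "a \<in> {1, -1}" "b \<in> {1, -1}"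
    using assms by (auto simp: grp_carrier_def)
  \<comment> \<open>The product twists the first parameter by the second sign, so an inverse with
    sign \<open>a\<close> needs a parameter cancelling \<open>a * s\<close>.\<close>
  show ?thesis
  proof (rule that[of "(qcnj u, (a, - a * s), b)"])
    show "(qcnj u, (a, - a * s), b) \<in> grp_carrier"
      using g by (auto simp: grp_carrier_def Sp1_closed)
  qed (use g in \<open>auto simp: grp_mult_def grp_one_def Sp1_qcnj\<close>)
qed

lemma slice_isometry_grp_act:
  assumes "g \<in> grp_carrier"
  shows "slice_isometry (restrict (grp_act g) qball)"
proof -
  obtain h where h: "h \<in> grp_carrier" "grp_mult g h = grp_one" "grp_mult h g = grp_one"
    using grp_inverse_exists[OF assms] .
  show ?thesis
    using metric_preserving_grp_act[OF assms] metric_preserving_grp_act[OF h(1)]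
  proof (rule slice_isometry_restrictI)
    show "grp_act h (grp_act g q) = q" "grp_act g (grp_act h q) = q" if "q \<in> qball" for q
      using grp_act_mult[OF h(1) assms that] grp_act_mult[OF assms h(1) that] h(2,3)
      by (simp_all add: grp_act_one)
  qed
qed

section \<open>The distance to the origin along curves\<close>

text \<open>The \<open>g\<close>-distance from 0 to \<open>q\<close>.\<close>

definition hnorm :: "quat \<Rightarrow> real" where
  "hnorm q = artanh (norm q)"

lemma tanh_artanh_real:
  assumes "\<bar>x\<bar> < 1"
  shows "tanh (artanh x) = (x :: real)"
proof -
  have "(1 + x) / (1 - x) > 0"
    using assms by (simp add: abs_less_iff)
  then show ?thesis
    using assms by (simp add: artanh_def tanh_real_altdef exp_minus) (simp add: field_simps)
qed

lemma tanh_hnorm: "q \<in> qball \<Longrightarrow> tanh (hnorm q) = norm q"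
  by (simp add: hnorm_def tanh_artanh_real qball_iff)

lemma hnorm_nonneg: "q \<in> qball \<Longrightarrow> hnorm q \<ge> 0"
  by (metis norm_ge_zero tanh_hnorm tanh_real_nonneg_iff)

lemma hnorm_eqI: "q \<in> qball \<Longrightarrow> norm q = tanh r \<Longrightarrow> hnorm q = r"
  by (metis tanh_hnorm tanh_real_eq_iff)

lemma hnorm_zero [simp]: "hnorm 0 = 0"
  by (simp add: hnorm_def)

lemma tanh_scaleR_in_qball: "norm u = 1 \<Longrightarrow> tanh t *\<^sub>R u \<in> qball"
  using tanh_real_bounds[of t] by (auto simp: qball_iff)

lemma hnorm_tanh_scaleR: "norm u = 1 \<Longrightarrow> hnorm (tanh t *\<^sub>R u) = \<bar>t\<bar>"
  by (rule hnorm_eqI[OF tanh_scaleR_in_qball]) simp_all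

lemma tanh_has_vector_derivative:
  "((\<lambda>t. tanh t *\<^sub>R (u :: quat)) has_vector_derivative (1 - (tanh t)\<^sup>2) *\<^sub>R u) (at t)"
proof -
  have "(tanh has_real_derivative 1 - (tanh t)\<^sup>2) (at t)"
    by (auto intro!: derivative_eq_intros)
  then show ?thesis
    using has_vector_derivative_scaleR[of tanh _ t UNIV "\<lambda>_. u" 0] by simp
qed

text \<open>The diameter is traversed at unit speed. Its velocity is (1 - T^2) / T times the point,
  so the formula for radial vectors applies except at the origin, where the metric is
  Euclidean.\<close>

lemma slice_metric_tanh_curve:
  assumes "norm u = 1"
  shows "slice_metric (tanh t *\<^sub>R u) ((1 - (tanh t)\<^sup>2) *\<^sub>R u) ((1 - (tanh t)\<^sup>2) *\<^sub>R u) = 1"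
proof (cases "t = 0")
  case True
  then show ?thesis
    using assms by (simp add: slice_metric_zero flip: power2_norm_eq_inner)
next
  case False
  define T where "T = tanh t"
  have T: "T \<noteq> 0" "T\<^sup>2 < 1"
    using False tanh_real_bounds[of t] by (auto simp: T_def abs_square_less_1)
  have q: "T *\<^sub>R u \<in> qball"
    unfolding T_def by (rule tanh_scaleR_in_qball[OF assms])
  have "slice_metric (T *\<^sub>R u) ((1 - T\<^sup>2) *\<^sub>R u) ((1 - T\<^sup>2) *\<^sub>R u) * (1 - T\<^sup>2)\<^sup>2 = (1 - T\<^sup>2)\<^sup>2"
    using slice_metric_parallel[OF q, of "(1 - T\<^sup>2) / T"] T assms by (simp add: power_divide)
  then show ?thesis
    using T by (simp add: T_def)
qed

lemma metric_preserving_curve: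
  assumes "metric_preserving f" "k t \<in> qball" "(k has_vector_derivative k') (at t)"
  obtains v where "((\<lambda>t. f (k t)) has_vector_derivative v) (at t)"
    "slice_metric (f (k t)) v v = slice_metric (k t) k' k'"
proof -
  obtain f' where f': "(f has_derivative f') (at (k t))"
    "\<And>\<alpha> \<beta>. slice_metric (f (k t)) (f' \<alpha>) (f' \<beta>) = slice_metric (k t) \<alpha> \<beta>"
    using metric_preserving_derivative[OF assms(1,2)] by blast
  have "((\<lambda>t. f (k t)) has_vector_derivative f' k') (at t)"
    using vector_derivative_diff_chain_within[of k k' t UNIV f f'] assms(3) f'(1)
    by (simp add: o_def has_derivative_at_withinI)
  then show ?thesis
    using f'(2) that by blast
qed

text \<open>The derivative is (k . v) / (|k| (1 - |k|^2)), which \<open>slice_metric_radial\<close>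
  bounds by the speed. At the origin the norm is not differentiable.\<close>

lemma hnorm_curve_derivative:
  assumes k: "(k has_vector_derivative v) (at t)" and ball: "k t \<in> qball" and "k t \<noteq> 0"
    and speed: "slice_metric (k t) v v \<le> K\<^sup>2" and "K \<ge> 0"
  obtains d where "((\<lambda>t. hnorm (k t)) has_real_derivative d) (at t)" "\<bar>d\<bar> \<le> K"
proof -
  define N where "N = norm (k t)"
  have N: "0 < N" "N < 1" "N\<^sup>2 < 1"
    using assms qball_norm_power2[OF ball] by (auto simp: N_def qball_iff)
  have "((\<lambda>t. sqrt (k t \<bullet> k t)) has_derivative (\<lambda>h. h * ((k t \<bullet> v) / N))) (at t)"
    using k \<open>k t \<noteq> 0\<close> unfolding has_vector_derivative_def N_def norm_eq_sqrt_inner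
    by (auto intro!: derivative_eq_intros simp: inner_commute field_simps)
  then have "((\<lambda>t. norm (k t)) has_real_derivative (k t \<bullet> v) / N) (at t)"
    unfolding has_field_derivative_def norm_eq_sqrt_inner
    by (rule has_derivative_eq_rhs) (simp add: fun_eq_iff)
  moreover have "(artanh has_real_derivative 1 / (1 - N\<^sup>2)) (at (norm (k t)))"
    using artanh_real_has_field_derivative[of N] N by (simp add: N_def)
  ultimately have "((\<lambda>t. hnorm (k t)) has_real_derivative 1 / (1 - N\<^sup>2) * ((k t \<bullet> v) / N)) (at t)"
    unfolding hnorm_def by (rule DERIV_chain2[rotated])
  moreover have "\<bar>1 / (1 - N\<^sup>2) * ((k t \<bullet> v) / N)\<bar> \<le> K"
  proof -
    have "(k t \<bullet> v)\<^sup>2 \<le> N\<^sup>2 * (1 - N\<^sup>2)\<^sup>2 * slice_metric (k t) v v"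
      using slice_metric_radial(1)[OF ball, of v] by (simp add: N_def)
    also have "\<dots> \<le> N\<^sup>2 * (1 - N\<^sup>2)\<^sup>2 * K\<^sup>2"
      using speed by (intro mult_left_mono) auto
    finally have "(k t \<bullet> v)\<^sup>2 \<le> (N * (1 - N\<^sup>2) * K)\<^sup>2"
      by (simp add: power_mult_distrib)
    then have "\<bar>k t \<bullet> v\<bar> \<le> N * (1 - N\<^sup>2) * K"
      using N \<open>K \<ge> 0\<close> by (simp add: abs_le_square_iff[symmetric] abs_mult)
    then show ?thesis
      using N by (simp add: abs_mult field_simps)
  qed
  ultimately show ?thesis
    by (rule that)
qed

lemma continuous_on_hnorm:
  assumes "continuous_on S k" "\<And>t. t \<in> S \<Longrightarrow> k t \<in> qball"
  shows "continuous_on S (\<lambda>t. hnorm (k t))"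
  unfolding hnorm_def
proof -
  have "norm (k t) \<in> {-1<..<1}" if "t \<in> S" for t
    using assms(2)[OF that] norm_ge_zero[of "k t"] by (simp add: qball_iff del: norm_ge_zero)
  then show "continuous_on S (\<lambda>t. artanh (norm (k t)))"
    by (intro continuous_on_compose2[OF continuous_on_artanh[of "{-1<..<1}"] continuous_on_norm[OF assms(1)]])
      auto
qed

text \<open>Where the curve avoids 0, the derivative bound integrates. If it meets 0, the estimate
  starts at the last zero \<open>z\<close>, where \<open>hnorm\<close> vanishes and so does not
  exceed its value at \<open>a\<close>.\<close>

lemma hnorm_curve_growth:
  assumes "a \<le> b" "K \<ge> 0"
    and k: "\<And>t. t \<in> {a..b} \<Longrightarrow> (k has_vector_derivative k' t) (at t)"
    and ball: "\<And>t. t \<in> {a..b} \<Longrightarrow> k t \<in> qball"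
    and speed: "\<And>t. t \<in> {a..b} \<Longrightarrow> slice_metric (k t) (k' t) (k' t) \<le> K\<^sup>2"
  shows "hnorm (k b) \<le> hnorm (k a) + K * (b - a)"
proof -
  have cont: "continuous_on {a..b} k"
    using k by (meson continuous_at_imp_continuous_on has_vector_derivative_continuous)
  have nonzero: "hnorm (k b) \<le> hnorm (k c) + K * (b - c)"
    if c: "c \<in> {a..b}" and nz: "\<And>t. c < t \<Longrightarrow> t < b \<Longrightarrow> k t \<noteq> 0" for c
  proof -
    have "K * c - hnorm (k c) \<le> K * b - hnorm (k b)"
    proof (rule DERIV_nonneg_imp_increasing_open[where f = "\<lambda>t. K * t - hnorm (k t)"])
      show "c \<le> b"
        using c by simp
      have "continuous_on {c..b} k"
        by (rule continuous_on_subset[OF cont]) (use c in auto)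
      then show "continuous_on {c..b} (\<lambda>t. K * t - hnorm (k t))"
        using c by (intro continuous_intros continuous_on_hnorm ball) auto
      fix t assume t: "c < t" "t < b"
      then have "t \<in> {a..b}"
        using c by auto
      then obtain d where "((\<lambda>t. hnorm (k t)) has_real_derivative d) (at t)" "\<bar>d\<bar> \<le> K"
        using hnorm_curve_derivative[OF k ball nz[OF t] speed \<open>K \<ge> 0\<close>] by blast
      then show "\<exists>y. ((\<lambda>t. K * t - hnorm (k t)) has_real_derivative y) (at t) \<and> y \<ge> 0"
        by (intro exI[of _ "K - d"]) (auto intro!: derivative_eq_intros)
    qed
    then show ?thesis
      by (simp add: algebra_simps)
  qed
  define Z where "Z = {t \<in> {a..b}. k t = 0}"
  show ?thesis
  proof (cases "Z = {}")
    case True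
    then show ?thesis
      using nonzero[of a] \<open>a \<le> b\<close> by (force simp: Z_def)
  next
    case False
    have "closed Z"
      unfolding Z_def by (rule continuous_closed_preimage_constant[OF cont]) simp
    moreover have "bounded Z"
      by (rule bounded_subset[OF bounded_closed_interval[of a b]]) (auto simp: Z_def)
    ultimately have "compact Z"
      by (simp add: compact_eq_bounded_closed)
    then obtain z where z: "z \<in> Z" "\<And>t. t \<in> Z \<Longrightarrow> t \<le> z"
      using compact_attains_sup[OF _ False] by blast
    have "hnorm (k b) \<le> hnorm (k z) + K * (b - z)"
    proof (rule nonzero)
      show "z \<in> {a..b}"
        using z(1) by (simp add: Z_def)
      show "k t \<noteq> 0" if t: "z < t" "t < b" for t
        using z(2)[of t] \<open>z \<in> {a..b}\<close> t by (auto simp: Z_def)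
    qed
    also have "\<dots> \<le> K * (b - a)"
      using z(1) \<open>K \<ge> 0\<close> by (auto simp: Z_def intro!: mult_left_mono)
    also have "\<dots> \<le> hnorm (k a) + K * (b - a)"
      using hnorm_nonneg[OF ball, of a] \<open>a \<le> b\<close> by simp
    finally show ?thesis .
  qed
qed

text \<open>The second inequality is the growth estimate for the reversed curve.\<close>

lemma hnorm_curve_lipschitz:
  assumes "a \<le> b" "K \<ge> 0"
    and k: "\<And>t. t \<in> {a..b} \<Longrightarrow> (k has_vector_derivative k' t) (at t)"
    and ball: "\<And>t. t \<in> {a..b} \<Longrightarrow> k t \<in> qball"
    and speed: "\<And>t. t \<in> {a..b} \<Longrightarrow> slice_metric (k t) (k' t) (k' t) \<le> K\<^sup>2"
  shows "\<bar>hnorm (k b) - hnorm (k a)\<bar> \<le> K * (b - a)"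
proof -
  have "hnorm (k b) \<le> hnorm (k a) + K * (b - a)"
    by (rule hnorm_curve_growth[OF assms])
  moreover have "hnorm (k (- (- a))) \<le> hnorm (k (- (- b))) + K * (- a - - b)"
  proof (rule hnorm_curve_growth[where k = "\<lambda>t. k (- t)" and k' = "\<lambda>t. - k' (- t)"])
    fix t assume "t \<in> {- b..- a}"
    then have t: "- t \<in> {a..b}"
      by auto
    have "((\<lambda>t. - t) has_vector_derivative - 1) (at t)"
      by (auto intro!: derivative_eq_intros)
    from vector_diff_chain_at[OF this k[OF t]]
    show "((\<lambda>t. k (- t)) has_vector_derivative - k' (- t)) (at t)"
      by (simp add: o_def)
    show "k (- t) \<in> qball"
      by (rule ball[OF t])
    have "slice_metric q (- \<alpha>) (- \<alpha>) = slice_metric q \<alpha> \<alpha>" for q \<alpha>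
    proof -
      have "- \<alpha> - q \<star>\<^sub>q (- \<alpha>) \<star>\<^sub>q q = - (\<alpha> - q \<star>\<^sub>q \<alpha> \<star>\<^sub>q q)"
        by (simp add: qmult.minus_left qmult.minus_right)
      then show ?thesis
        unfolding slice_metric_inner by (simp only: inner_minus_left inner_minus_right minus_minus)
    qed
    then show "slice_metric (k (- t)) (- k' (- t)) (- k' (- t)) \<le> K\<^sup>2"
      using speed[OF t] by simp
  qed (use assms in auto)
  ultimately show ?thesis
    by (simp add: abs_le_iff)
qed

lemma hnorm_metric_preserving_curve:
  assumes "metric_preserving f" "a \<le> b" "K \<ge> 0"
    and k: "\<And>t. t \<in> {a..b} \<Longrightarrow> (k has_vector_derivative k' t) (at t)"
    and ball: "\<And>t. t \<in> {a..b} \<Longrightarrow> k t \<in> qball"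
    and speed: "\<And>t. t \<in> {a..b} \<Longrightarrow> slice_metric (k t) (k' t) (k' t) \<le> K\<^sup>2"
  shows "\<bar>hnorm (f (k b)) - hnorm (f (k a))\<bar> \<le> K * (b - a)"
proof -
  have "\<exists>v. ((\<lambda>t. f (k t)) has_vector_derivative v) (at t) \<and> slice_metric (f (k t)) v v \<le> K\<^sup>2"
    if t: "t \<in> {a..b}" for t
  proof -
    obtain v where v: "((\<lambda>t. f (k t)) has_vector_derivative v) (at t)"
      "slice_metric (f (k t)) v v = slice_metric (k t) (k' t) (k' t)"
      using metric_preserving_curve[OF assms(1) ball[OF t] k[OF t]] .
    then show ?thesis
      using speed[OF t] by (intro exI[of _ v]) simp
  qed
  then obtain v where "\<And>t. t \<in> {a..b} \<Longrightarrow> ((\<lambda>t. f (k t)) has_vector_derivative v t) (at t)"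
    "\<And>t. t \<in> {a..b} \<Longrightarrow> slice_metric (f (k t)) (v t) (v t) \<le> K\<^sup>2"
    by metis
  then show ?thesis
    using hnorm_curve_lipschitz[OF assms(2,3), of "\<lambda>t. f (k t)" v]
      metric_preserving_in_qball[OF assms(1) ball] by blast
qed

lemma hnorm_tanh_curve_lipschitz:
  assumes "metric_preserving f" "norm u = 1"
  shows "\<bar>hnorm (f (tanh t *\<^sub>R u)) - hnorm (f (tanh s *\<^sub>R u))\<bar> \<le> \<bar>t - s\<bar>"
proof -
  have *: "\<bar>hnorm (f (tanh t *\<^sub>R u)) - hnorm (f (tanh s *\<^sub>R u))\<bar> \<le> 1 * (t - s)" if "s \<le> t" for s t
    using assms that
    by (intro hnorm_metric_preserving_curve[where k = "\<lambda>t. tanh t *\<^sub>R u"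
          and k' = "\<lambda>t. (1 - (tanh t)\<^sup>2) *\<^sub>R u"] tanh_has_vector_derivative)
      (simp_all add: tanh_scaleR_in_qball slice_metric_tanh_curve)
  show ?thesis
    using *[of s t] *[of t s] by (cases "s \<le> t") auto
qed

lemma qball_polar:
  assumes "q \<in> qball"
  obtains u where "norm u = 1" "q = tanh (hnorm q) *\<^sub>R u"
proof (cases "q = 0")
  case True
  then show ?thesis
    using that[of "qreal 1"] by simp
next
  case False
  then show ?thesis
    using that[of "inverse (norm q) *\<^sub>R q"] tanh_hnorm[OF assms] by simp
qed

text \<open>The diameter from 0 to \<open>q\<close> has length \<open>hnorm q\<close>. For
  invertible \<open>f\<close>, where \<open>hnorm (f q)\<close> is the distance from
  \<open>q\<close> to the preimage of 0, this is the triangle inequality.\<close>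

lemma hnorm_metric_preserving:
  assumes "metric_preserving f" "q \<in> qball"
  shows "\<bar>hnorm (f q) - hnorm (f 0)\<bar> \<le> hnorm q"
proof -
  obtain u where u: "norm u = 1" "q = tanh (hnorm q) *\<^sub>R u"
    using qball_polar[OF assms(2)] .
  have "\<bar>hnorm (f (tanh (hnorm q) *\<^sub>R u)) - hnorm (f (tanh 0 *\<^sub>R u))\<bar> \<le> \<bar>hnorm q - 0\<bar>"
    by (rule hnorm_tanh_curve_lipschitz[OF assms(1) u(1)])
  then show ?thesis
    using hnorm_nonneg[OF assms(2)] by (simp flip: u(2))
qed

text \<open>Equality in the radial estimate forces the velocity to be radial.\<close>
lemma radial_curve_derivative:
  assumes k: "(k has_vector_derivative v) (at t)" and ball: "k t \<in> qball" and "t \<noteq> r"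
    and unit: "slice_metric (k t) v v = 1"
    and "open S" "t \<in> S" and norm: "\<And>s. s \<in> S \<Longrightarrow> norm (k s) = \<bar>tanh (s - r)\<bar>"
  shows "((\<lambda>s. inverse (tanh (s - r)) *\<^sub>R k s) has_vector_derivative 0) (at t)"
proof -
  define T where "T = tanh (t - r)"
  have T: "T \<noteq> 0"
    using \<open>t \<noteq> r\<close> by (simp add: T_def)
  have dT: "((\<lambda>s. tanh (s - r)) has_real_derivative 1 - T\<^sup>2) (at t)"
    unfolding T_def by (auto intro!: derivative_eq_intros)
  have kk: "k s \<bullet> k s = (tanh (s - r))\<^sup>2" if "s \<in> S" for s
    using norm[OF that] by (simp flip: power2_norm_eq_inner)
  have N: "(norm (k t))\<^sup>2 = T\<^sup>2"
    using kk[OF \<open>t \<in> S\<close>] by (simp add: T_def power2_norm_eq_inner)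
  have "((\<lambda>s. k s \<bullet> k s) has_real_derivative 2 * (k t \<bullet> v)) (at t)"
    using k unfolding has_vector_derivative_def has_field_derivative_def
    by (auto intro!: derivative_eq_intros simp: inner_commute)
  moreover have "((\<lambda>s. k s \<bullet> k s) has_real_derivative 2 * (T * (1 - T\<^sup>2))) (at t)"
  proof (rule has_field_derivative_transform_within_open[OF _ \<open>open S\<close> \<open>t \<in> S\<close>])
    show "((\<lambda>s. (tanh (s - r))\<^sup>2) has_real_derivative 2 * (T * (1 - T\<^sup>2))) (at t)"
      using dT by (auto intro!: derivative_eq_intros simp: T_def)
  qed (simp add: kk)
  \<comment> \<open>Comparing two derivatives of |k|^2 fixes the radial component of the velocity.
    Together with unit speed this is the equality case of
    \<open>slice_metric_radial\<close>.\<close>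
  ultimately have inner: "k t \<bullet> v = T * (1 - T\<^sup>2)"
    using DERIV_unique by fastforce
  then have "(k t \<bullet> v)\<^sup>2 = (norm (k t))\<^sup>2 * (1 - (norm (k t))\<^sup>2)\<^sup>2 * slice_metric (k t) v v"
    unfolding N unit by (simp add: power_mult_distrib)
  from slice_metric_radial(2)[OF ball this] have "T\<^sup>2 *\<^sub>R v = (T * (1 - T\<^sup>2)) *\<^sub>R k t"
    unfolding N inner .
  then have "(T * T) *\<^sub>R v = (T * T) *\<^sub>R (((1 - T\<^sup>2) / T) *\<^sub>R k t)"
    using T by (simp add: power2_eq_square)
  then have v: "v = ((1 - T\<^sup>2) / T) *\<^sub>R k t"
    using T by (simp only: scaleR_cancel_left mult_eq_0_iff) simp
  have "((\<lambda>s. inverse (tanh (s - r))) has_real_derivative - (inverse T * (1 - T\<^sup>2) * inverse T)) (at t)"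
    using DERIV_inverse'[OF dT] T by (simp add: T_def)
  from has_vector_derivative_scaleR[OF this k]
  show ?thesis
    using T by (simp add: v T_def[symmetric] field_simps)
qed

text \<open>On an interval avoiding \<open>r\<close>, the quotient of the curve by
  \<open>tanh (t - r)\<close> has derivative 0.\<close>

lemma radial_curve_one_side:
  fixes k :: "real \<Rightarrow> quat"
  assumes "convex S" "open S" "r \<notin> S"
    and k: "\<And>t. t \<in> S \<Longrightarrow> \<exists>v. (k has_vector_derivative v) (at t) \<and> slice_metric (k t) v v = 1"
    and ball: "\<And>t. t \<in> S \<Longrightarrow> k t \<in> qball"
    and norm: "\<And>t. t \<in> S \<Longrightarrow> norm (k t) = \<bar>tanh (t - r)\<bar>"
  obtains c where "\<And>t. t \<in> S \<Longrightarrow> k t = tanh (t - r) *\<^sub>R c"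
proof -
  have deriv: "((\<lambda>s. inverse (tanh (s - r)) *\<^sub>R k s) has_derivative (\<lambda>h. 0)) (at t within S)"
    if t: "t \<in> S" for t
  proof -
    obtain v where "(k has_vector_derivative v) (at t)" "slice_metric (k t) v v = 1"
      using k[OF t] by blast
    then have "((\<lambda>s. inverse (tanh (s - r)) *\<^sub>R k s) has_vector_derivative 0) (at t)"
      using t \<open>r \<notin> S\<close> by (intro radial_curve_derivative[OF _ ball[OF t] _ _ \<open>open S\<close> t norm]) auto
    then show ?thesis
      by (simp add: has_vector_derivative_def has_derivative_at_withinI)
  qed
  have "\<exists>c. \<forall>t\<in>S. inverse (tanh (t - r)) *\<^sub>R k t = c"
    by (rule has_derivative_zero_constant[OF \<open>convex S\<close> deriv])
  then obtain c where c: "\<And>t. t \<in> S \<Longrightarrow> inverse (tanh (t - r)) *\<^sub>R k t = c"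
    by blast
  have "k t = tanh (t - r) *\<^sub>R c" if t: "t \<in> S" for t
  proof -
    have "tanh (t - r) \<noteq> 0"
      using t \<open>r \<notin> S\<close> by auto
    then show ?thesis
      by (simp flip: c[OF t])
  qed
  then show ?thesis
    by (rule that)
qed

text \<open>Each side of \<open>r\<close> gives a ray with its own direction. Both directions are
  one-sided derivatives at \<open>r\<close>, hence equal to \<open>v\<close>: the curve passes
  straight through 0.\<close>

lemma radial_curve:
  fixes k :: "real \<Rightarrow> quat"
  assumes "a < r" "r < b"
    and k: "\<And>t. t \<in> {a<..<b} \<Longrightarrow> \<exists>v. (k has_vector_derivative v) (at t) \<and> slice_metric (k t) v v = 1"
    and ball: "\<And>t. t \<in> {a<..<b} \<Longrightarrow> k t \<in> qball"
    and norm: "\<And>t. t \<in> {a<..<b} \<Longrightarrow> norm (k t) = \<bar>tanh (t - r)\<bar>"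
    and v: "(k has_vector_derivative v) (at r)"
    and "t \<in> {a<..<b}"
  shows "k t = tanh (t - r) *\<^sub>R v"
proof -
  have kr: "k r = 0"
    using norm[of r] assms(1,2) by simp
  have shift: "((\<lambda>s. tanh (s - r) *\<^sub>R c) has_vector_derivative c) (at r)" for c :: quat
  proof -
    have "((\<lambda>s. tanh (s - r)) has_real_derivative 1) (at r)"
      by (auto intro!: derivative_eq_intros)
    from has_vector_derivative_scaleR[OF this has_vector_derivative_const[of c]] show ?thesis
      by simp
  qed
  have right: "k t = tanh (t - r) *\<^sub>R v" if t: "r < t" "t < b" for t
  proof -
    obtain c where c: "\<And>t. t \<in> {r<..<b} \<Longrightarrow> k t = tanh (t - r) *\<^sub>R c"
    proof (rule radial_curve_one_side[of "{r<..<b}" r k])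
      fix t assume "t \<in> {r<..<b}"
      then have "t \<in> {a<..<b}"
        using \<open>a < r\<close> by simp
      then show "\<exists>v. (k has_vector_derivative v) (at t) \<and> slice_metric (k t) v v = 1"
        "k t \<in> qball" "norm (k t) = \<bar>tanh (t - r)\<bar>"
        by (rule k, rule ball, rule norm)
    qed auto
    have eq: "tanh (s - r) *\<^sub>R c = k s" if "s \<in> {r..t}" for s
      using c[of s] that t kr by (cases "s = r") auto
    have "((\<lambda>s. tanh (s - r) *\<^sub>R c) has_vector_derivative c) (at r within {r..t})"
      by (rule has_vector_derivative_at_within[OF shift])
    then have "(k has_vector_derivative c) (at r within {r..t})"
      by (rule has_vector_derivative_transform[rotated 2]) (use eq t in auto)
    then have "c = v"
      using vector_derivative_unique_within_closed_interval[of r t r k c v] t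
        has_vector_derivative_at_within[OF v, of "{r..t}"] by simp
    then show ?thesis
      using c[of t] t by simp
  qed
  have left: "k t = tanh (t - r) *\<^sub>R v" if t: "a < t" "t < r" for t
  proof -
    obtain c where c: "\<And>t. t \<in> {a<..<r} \<Longrightarrow> k t = tanh (t - r) *\<^sub>R c"
    proof (rule radial_curve_one_side[of "{a<..<r}" r k])
      fix t assume "t \<in> {a<..<r}"
      then have "t \<in> {a<..<b}"
        using \<open>r < b\<close> by simp
      then show "\<exists>v. (k has_vector_derivative v) (at t) \<and> slice_metric (k t) v v = 1"
        "k t \<in> qball" "norm (k t) = \<bar>tanh (t - r)\<bar>"
        by (rule k, rule ball, rule norm)
    qed auto
    have eq: "tanh (s - r) *\<^sub>R c = k s" if "s \<in> {t..r}" for s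
      using c[of s] that t kr by (cases "s = r") auto
    have "((\<lambda>s. tanh (s - r) *\<^sub>R c) has_vector_derivative c) (at r within {t..r})"
      by (rule has_vector_derivative_at_within[OF shift])
    then have "(k has_vector_derivative c) (at r within {t..r})"
      by (rule has_vector_derivative_transform[rotated 2]) (use eq t in auto)
    then have "c = v"
      using vector_derivative_unique_within_closed_interval[of t r r k c v] t
        has_vector_derivative_at_within[OF v, of "{t..r}"] by simp
    then show ?thesis
      using c[of t] t by simp
  qed
  show ?thesis
    using right[of t] left[of t] kr \<open>t \<in> {a<..<b}\<close> by (cases t r rule: linorder_cases) auto
qed

text \<open>Neither \<open>f\<close> nor \<open>e\<close> increases \<open>hnorm\<close>, so
  \<open>f\<close> preserves the norm. A diameter therefore goes to a unit-speed curve satisfying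
  the hypotheses of \<open>radial_curve\<close>, and its image is the diameter in the direction
  given by the derivative \<open>L\<close> at 0.\<close>

lemma metric_preserving_fixing_zero_linear:
  assumes f: "metric_preserving f" and e: "metric_preserving e"
    and ef: "\<And>q. q \<in> qball \<Longrightarrow> e (f q) = q" and "f 0 = 0"
  obtains L where "linear L" "\<And>p q. L p \<bullet> L q = p \<bullet> q" "\<And>q. q \<in> qball \<Longrightarrow> f q = L q"
proof -
  have zero: "0 \<in> qball"
    by (simp add: qball_iff)
  have "e 0 = 0"
    using ef[OF zero] \<open>f 0 = 0\<close> by simp
  have norm: "norm (f q) = norm q" if q: "q \<in> qball" for q
  proof -
    have fq: "f q \<in> qball"
      by (rule metric_preserving_in_qball[OF f q])
    have "hnorm (f q) = hnorm q"
      using hnorm_metric_preserving[OF f q] hnorm_metric_preserving[OF e fq] ef[OF q]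
        \<open>f 0 = 0\<close> \<open>e 0 = 0\<close> by simp
    then show ?thesis
      using tanh_hnorm[OF q] tanh_hnorm[OF fq] by simp
  qed
  obtain L where L: "(f has_derivative L) (at 0)"
    "\<And>\<alpha> \<beta>. slice_metric (f 0) (L \<alpha>) (L \<beta>) = slice_metric 0 \<alpha> \<beta>"
    using metric_preserving_derivative[OF f zero] by blast
  have linear: "linear L"
    using L(1) by (simp add: has_derivative_bounded_linear bounded_linear.linear)
  have line: "f (tanh t *\<^sub>R u) = tanh t *\<^sub>R L u" if u: "norm u = 1" for t u
  proof -
    have "f (tanh t *\<^sub>R u) = tanh (t - 0) *\<^sub>R L u"
    proof (rule radial_curve[where a = "- \<bar>t\<bar> - 1" and b = "\<bar>t\<bar> + 1" and r = 0
          and k = "\<lambda>t. f (tanh t *\<^sub>R u)"])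
      fix s
      show "\<exists>v. ((\<lambda>t. f (tanh t *\<^sub>R u)) has_vector_derivative v) (at s) \<and>
          slice_metric (f (tanh s *\<^sub>R u)) v v = 1"
        using metric_preserving_curve[OF f tanh_scaleR_in_qball[OF u] tanh_has_vector_derivative]
          slice_metric_tanh_curve[OF u] by metis
      show "f (tanh s *\<^sub>R u) \<in> qball"
        by (intro metric_preserving_in_qball[OF f] tanh_scaleR_in_qball u)
      show "norm (f (tanh s *\<^sub>R u)) = \<bar>tanh (s - 0)\<bar>"
        using norm[OF tanh_scaleR_in_qball[OF u]] u by simp
    next
      show "((\<lambda>t. f (tanh t *\<^sub>R u)) has_vector_derivative L u) (at 0)"
        using vector_derivative_diff_chain_within[of "\<lambda>t. tanh t *\<^sub>R u" u 0 UNIV f L]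
          tanh_has_vector_derivative[of u 0] L(1)
        by (simp add: o_def has_derivative_at_withinI)
    qed auto
    then show ?thesis
      by simp
  qed
  show ?thesis
  proof (rule that[OF linear])
    show "L p \<bullet> L q = p \<bullet> q" for p q
      using L(2)[of p q] by (simp add: \<open>f 0 = 0\<close> slice_metric_zero)
    show "f q = L q" if q: "q \<in> qball" for q
    proof -
      obtain u where "norm u = 1" "q = tanh (hnorm q) *\<^sub>R u"
        using qball_polar[OF q] .
      then show ?thesis
        using line[of u "hnorm q"] by (metis linear linear_scale)
    qed
  qed
qed

section \<open>An isometry maps the origin to a real point\<close>

text \<open>While the hyperbolic radius moves from \<open>r\<close> to \<open>R\<close>, the
  direction makes half a turn from \<open>b\<close> to \<open>- b\<close> in the imaginary plane of
  \<open>b\<close> and \<open>c\<close>. The radial motion contributes (R - r)^2 to the squared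
  speed. The rotation is orthogonal to the slice plane and contributes pi^2 T^2 / (n^2 + 4 T^2), at
  most pi^2.\<close>

lemma helix_speed:
  fixes r R :: real and b c :: "real \<times> real \<times> real"
  assumes "norm b = 1" "norm c = 1" "b \<bullet> c = 0"
  defines "h \<equiv> \<lambda>s. tanh (r + (R - r) * s) *\<^sub>R (cos (pi * s) *\<^sub>R (0 :: real, b) + sin (pi * s) *\<^sub>R (0, c))"
  obtains v where "(h has_vector_derivative v) (at s)" "h s \<in> qball"
    "slice_metric (h s) v v \<le> (R - r)\<^sup>2 + pi\<^sup>2"
proof -
  define T where "T = tanh (r + (R - r) * s)"
  define C S where "C = cos (pi * s)" and "S = sin (pi * s)"
  define n where "n = 1 - T\<^sup>2"
  have T: "T\<^sup>2 < 1"
    using tanh_real_bounds[of "r + (R - r) * s"] by (auto simp: T_def abs_square_less_1)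
  then have n: "n > 0"
    by (simp add: n_def)
  have CS: "C\<^sup>2 + S\<^sup>2 = 1"
    by (simp add: C_def S_def)
  have bc: "b \<bullet> b = 1" "c \<bullet> c = 1" "c \<bullet> b = 0"
    using assms by (simp_all add: inner_commute flip: power2_norm_eq_inner)
  define m m' where "m = C *\<^sub>R b + S *\<^sub>R c" and "m' = (- S) *\<^sub>R b + C *\<^sub>R c"
  have m: "m \<bullet> m = 1" "m \<bullet> m' = 0" "m' \<bullet> m' = 1"
    using CS by (simp_all add: m_def m'_def inner_add_left inner_add_right bc assms(3)
        power2_eq_square algebra_simps)
  have hs: "h s = (0, T *\<^sub>R m)"
    by (simp add: h_def T_def m_def C_def S_def)
  define v where "v = T *\<^sub>R (pi *\<^sub>R m') + (n * (R - r)) *\<^sub>R m"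
  have dT: "((\<lambda>s. tanh (r + (R - r) * s)) has_real_derivative n * (R - r)) (at s)"
    unfolding n_def T_def by (auto intro!: derivative_eq_intros)
  have dcos: "((\<lambda>s. cos (pi * s)) has_real_derivative - pi * S) (at s)"
    and dsin: "((\<lambda>s. sin (pi * s)) has_real_derivative pi * C) (at s)"
    unfolding S_def C_def by (auto intro!: derivative_eq_intros)
  have "((\<lambda>s. cos (pi * s) *\<^sub>R (0 :: real, b) + sin (pi * s) *\<^sub>R (0, c)) has_vector_derivative
      ((- pi * S) *\<^sub>R (0, b) + (pi * C) *\<^sub>R (0, c))) (at s)"
    using has_vector_derivative_add[OF
        has_vector_derivative_scaleR[OF dcos has_vector_derivative_const[of "(0 :: real, b)"]]
        has_vector_derivative_scaleR[OF dsin has_vector_derivative_const[of "(0 :: real, c)"]]]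
    by simp
  from has_vector_derivative_scaleR[OF dT this]
  have "(h has_vector_derivative (0, v)) (at s)"
    unfolding h_def v_def m_def m'_def T_def C_def S_def
    by (simp add: algebra_simps)
  moreover have norm_h: "(norm (0 :: real, T *\<^sub>R m))\<^sup>2 = T\<^sup>2"
    unfolding power2_norm_eq_inner using m by (simp add: power2_eq_square)
  then have "(norm (h s))\<^sup>2 < 1"
    unfolding hs using T by (simp only:)
  then have "h s \<in> qball"
    by (simp add: qball_iff abs_square_less_1)
  moreover have "slice_metric (h s) (0, v) (0, v) \<le> (R - r)\<^sup>2 + pi\<^sup>2"
  proof -
    define D where "D = n\<^sup>2 + 4 * T\<^sup>2"
    have D: "D > 0"
      unfolding D_def using n by (simp add: add_pos_nonneg)
    have nTm: "(norm (T *\<^sub>R m))\<^sup>2 = T\<^sup>2"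
      unfolding power2_norm_eq_inner using m by (simp add: power2_eq_square)
    have nv: "(norm (0 :: real, v))\<^sup>2 = T\<^sup>2 * pi\<^sup>2 + n\<^sup>2 * (R - r)\<^sup>2"
      unfolding power2_norm_eq_inner
      using m by (simp add: v_def inner_add_left inner_add_right inner_commute[of m' m]
          power2_eq_square algebra_simps)
    have mv: "(T *\<^sub>R m) \<bullet> v = T * (n * (R - r))"
      using m by (simp add: v_def inner_add_right)
    have "slice_metric (h s) (0, v) (0, v) =
        (n\<^sup>2 * (T\<^sup>2 * pi\<^sup>2 + n\<^sup>2 * (R - r)\<^sup>2) + 4 * (T * (n * (R - r)))\<^sup>2) / (D * n\<^sup>2)"
      unfolding hs slice_metric_quadratic norm_h nTm nv mv n_def[symmetric] D_def by simp
    also have "\<dots> = ((R - r)\<^sup>2 * (D * n\<^sup>2) + (T\<^sup>2 * pi\<^sup>2) * n\<^sup>2) / (D * n\<^sup>2)"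
      unfolding D_def by (simp add: power2_eq_square algebra_simps)
    also have "\<dots> = (R - r)\<^sup>2 + T\<^sup>2 * pi\<^sup>2 / D"
      using n D by (simp add: add_divide_distrib)
    also have "T\<^sup>2 * pi\<^sup>2 / D \<le> pi\<^sup>2"
    proof -
      have "T\<^sup>2 * pi\<^sup>2 \<le> D * pi\<^sup>2"
        by (intro mult_right_mono) (simp_all add: D_def)
      then show ?thesis
        using D by (simp add: divide_le_eq mult.commute)
    qed
    finally show ?thesis
      by simp
  qed
  ultimately show ?thesis
    by (rule that)
qed

lemma helix_bound:
  fixes b c :: "real \<times> real \<times> real"
  assumes "metric_preserving e" "norm b = 1" "norm c = 1" "b \<bullet> c = 0"
  shows "\<bar>hnorm (e (- tanh R *\<^sub>R (0, b))) - hnorm (e (tanh r *\<^sub>R (0, b)))\<bar> \<le> sqrt ((R - r)\<^sup>2 + pi\<^sup>2)"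
proof -
  define h where "h = (\<lambda>s. tanh (r + (R - r) * s) *\<^sub>R
    (cos (pi * s) *\<^sub>R (0 :: real, b) + sin (pi * s) *\<^sub>R (0, c)))"
  have "\<exists>v. (h has_vector_derivative v) (at s) \<and> h s \<in> qball \<and>
      slice_metric (h s) v v \<le> (sqrt ((R - r)\<^sup>2 + pi\<^sup>2))\<^sup>2" for s
    using helix_speed[OF assms(2-4), of r R s] unfolding h_def by fastforce
  then obtain v where v: "\<And>s. (h has_vector_derivative v s) (at s)" "\<And>s. h s \<in> qball"
      "\<And>s. slice_metric (h s) (v s) (v s) \<le> (sqrt ((R - r)\<^sup>2 + pi\<^sup>2))\<^sup>2"
    by metis
  have "\<bar>hnorm (e (h 1)) - hnorm (e (h 0))\<bar> \<le> sqrt ((R - r)\<^sup>2 + pi\<^sup>2) * (1 - 0)"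
    using assms(1) v by (intro hnorm_metric_preserving_curve[where k' = v]) auto
  then show ?thesis
    by (simp add: h_def)
qed

text \<open>If \<open>f 0\<close> is a nonzero imaginary point, then the \<open>f\<close>-image of the line through \<open>0\<close> and the
  preimage of \<open>0\<close> is the Euclidean line through \<open>f 0\<close> and \<open>0\<close>, along which the distance from \<open>f 0\<close>
  grows forever. A helix around the real axis joins far points of this line faster, because the
  rotational directions stay bounded.\<close>
lemma metric_preserving_imaginary_zero:
  assumes f: "metric_preserving f" and e: "metric_preserving e"
    and ef: "\<And>q. q \<in> qball \<Longrightarrow> e (f q) = q" and fe: "\<And>q. q \<in> qball \<Longrightarrow> f (e q) = q"
    and im: "fst (f 0) = 0"
  shows "f 0 = 0"
proof (rule ccontr)
  assume nz: "f 0 \<noteq> 0"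
  have zero: "0 \<in> qball"
    by (simp add: qball_iff)
  define p w where "p = f 0" and "w = e 0"
  have p: "p \<in> qball" and w: "w \<in> qball"
    using metric_preserving_in_qball[OF f zero] metric_preserving_in_qball[OF e zero]
    by (simp_all add: p_def w_def)
  have ep: "e p = 0" and fw: "f w = 0"
    using ef[OF zero] fe[OF zero] by (simp_all add: p_def w_def)
  define r where "r = hnorm p"
  have "tanh r \<noteq> 0"
    using tanh_hnorm[OF p] nz by (simp add: r_def p_def)
  then have r: "r > 0"
    using hnorm_nonneg[OF p] by (simp add: r_def)
  \<comment> \<open>Neither \<open>f\<close> nor \<open>e\<close> increases distances: from
    \<open>w\<close> and 0 to 0 and \<open>p\<close>, and back.\<close>
  have w_r: "hnorm w = r"
    using hnorm_metric_preserving[OF f w] hnorm_metric_preserving[OF e p] hnorm_nonneg[OF w] r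
    by (simp add: ep fw r_def flip: p_def w_def)
  obtain v where v: "norm v = 1" "w = tanh r *\<^sub>R v"
    using qball_polar[OF w] unfolding w_r .
  \<comment> \<open>The image of the diameter through \<open>w\<close>: it starts at
    \<open>p\<close> for parameter 0 and reaches 0 at parameter \<open>r\<close>.\<close>
  define k where "k = (\<lambda>t. f (tanh t *\<^sub>R v))"
  have k_ball: "k t \<in> qball" for t
    unfolding k_def by (intro metric_preserving_in_qball[OF f] tanh_scaleR_in_qball v)
  have k0: "k 0 = p" and kr: "k r = 0"
    by (simp_all add: k_def p_def fw flip: v(2))
  have ek: "e (k t) = tanh t *\<^sub>R v" for t
    unfolding k_def by (intro ef tanh_scaleR_in_qball v)
  \<comment> \<open>The upper bound is the length of the curve between the parameters
    \<open>r\<close> and \<open>t\<close>. The lower bound compares the distances of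
    \<open>e (k t)\<close> and \<open>w\<close> from 0, which are \<open>t\<close> and
    \<open>r\<close> for nonnegative \<open>t\<close>.\<close>
  have hnorm_k: "hnorm (k t) = \<bar>t - r\<bar>" if "t \<ge> 0" for t
  proof -
    have "hnorm (k t) \<le> \<bar>t - r\<bar>"
      using hnorm_tanh_curve_lipschitz[OF f v(1), of t r] kr by (simp add: k_def)
    moreover have "\<bar>t - r\<bar> \<le> hnorm (k t)"
      using hnorm_metric_preserving[OF e k_ball[of t]] that
      unfolding ek hnorm_tanh_scaleR[OF v(1)] w_def[symmetric] w_r by simp
    ultimately show ?thesis
      by simp
  qed
  have norm_k: "norm (k t) = \<bar>tanh (t - r)\<bar>" if "t \<ge> 0" for t
    using tanh_hnorm[OF k_ball[of t]] unfolding hnorm_k[OF that] by simp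
  have k_deriv: "\<exists>v. (k has_vector_derivative v) (at t) \<and> slice_metric (k t) v v = 1" for t
    using metric_preserving_curve[OF f tanh_scaleR_in_qball[OF v(1)] tanh_has_vector_derivative]
      slice_metric_tanh_curve[OF v(1)] unfolding k_def by metis
  obtain a where a: "(k has_vector_derivative a) (at r)"
    using k_deriv by blast
  \<comment> \<open>The comparison with the helix will give (r + R)^2 at most (R - r)^2 + pi^2, that
    is, 4 R r at most pi^2; this choice makes R r equal to pi^2.\<close>
  define R where "R = pi\<^sup>2 / r"
  have R: "R > 0"
    using r by (simp add: R_def)
  \<comment> \<open>The norm is known only for nonnegative parameters, so the open interval starts
    at 0; its upper end leaves room for the point \<open>r + R\<close>.\<close>
  have line: "k t = tanh (t - r) *\<^sub>R a" if "0 < t" "t < r + R + 1" for t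
    using r R k_deriv k_ball norm_k a that
    by (intro radial_curve[of 0 r "r + R + 1"]) auto
  have "norm a = 1"
    using line[of "r + R"] norm_k[of "r + R"] r R by simp
  \<comment> \<open>The parameter 0 of \<open>p\<close> is an endpoint of the open interval and is
    reached by continuity.\<close>
  have "p - tanh (0 - r) *\<^sub>R a = 0"
    unfolding k0[symmetric]
  proof (rule continuous_constant_on_closure[where S = "{0<..<r}" and x = 0
        and f = "\<lambda>t. k t - tanh (t - r) *\<^sub>R a"])
    have "continuous_on UNIV k"
      using k_deriv by (meson continuous_at_imp_continuous_on has_vector_derivative_continuous)
    then have "continuous_on (closure {0<..<r}) k"
      by (rule continuous_on_subset) simp
    then show "continuous_on (closure {0<..<r}) (\<lambda>t. k t - tanh (t - r) *\<^sub>R a)"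
      by (intro continuous_intros) auto
    show "k t - tanh (t - r) *\<^sub>R a = 0" if "t \<in> {0<..<r}" for t
      using line[of t] that R by simp
  qed (use r in auto)
  then have p_a: "p = tanh r *\<^sub>R (- a)"
    by (simp add: eq_neg_iff_add_eq_0)
  have "fst a = 0"
    using im r by (simp add: p_a flip: p_def)
  then obtain b where b: "- a = (0, b)"
    by (cases a) simp
  have "norm b = 1"
    using \<open>norm a = 1\<close> norm_minus_cancel[of a] unfolding b by (simp add: norm_Pair)
  \<comment> \<open>Any imaginary direction orthogonal to \<open>b\<close> can serve for the turn of
    the helix.\<close>
  obtain c' where c': "c' \<noteq> 0" "orthogonal b c'"
    using orthogonal_to_vector_exists[of b] by auto
  define c where "c = inverse (norm c') *\<^sub>R c'"
  have c: "norm c = 1" "b \<bullet> c = 0"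
    using c' by (simp_all add: c_def orthogonal_def)
  have "k (r + R) = - tanh R *\<^sub>R (0, b)"
    using line[of "r + R"] r R by (simp flip: b)
  then have "\<bar>hnorm (e (k (r + R))) - hnorm (e p)\<bar> \<le> sqrt ((R - r)\<^sup>2 + pi\<^sup>2)"
    using helix_bound[OF e \<open>norm b = 1\<close> c, of R r] p_a b by simp
  then have "r + R \<le> sqrt ((R - r)\<^sup>2 + pi\<^sup>2)"
    unfolding ek ep using r R by (simp add: hnorm_tanh_scaleR[OF v(1)])
  then have "(r + R)\<^sup>2 \<le> (R - r)\<^sup>2 + pi\<^sup>2"
    using r R by (simp add: real_le_rsqrt sqrt_ge_absD)
  then have "4 * (R * r) \<le> pi\<^sup>2"
    by (simp add: power2_eq_square algebra_simps)
  moreover have "R * r = pi\<^sup>2"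
    using r by (simp add: R_def)
  ultimately show False
    by simp
qed

section \<open>Isometries fixing the origin\<close>

abbreviation (input) qi :: quat where "qi \<equiv> (0, 1, 0, 0)"
abbreviation (input) qj :: quat where "qj \<equiv> (0, 0, 1, 0)"
abbreviation (input) qk :: quat where "qk \<equiv> (0, 0, 0, 1)"

lemma quat_basis: "(a, b, c, d) = a *\<^sub>R qreal 1 + b *\<^sub>R qi + c *\<^sub>R qj + d *\<^sub>R qk"
  by (simp add: qreal_def)

lemma quat_units_mult:
  "qi \<star>\<^sub>q qi = - qreal 1" "qj \<star>\<^sub>q qj = - qreal 1" "qk \<star>\<^sub>q qk = - qreal 1"
  "qi \<star>\<^sub>q qj = qk" "qj \<star>\<^sub>q qi = - qk" "qj \<star>\<^sub>q qk = qi" "qk \<star>\<^sub>q qj = - qi"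
  "qk \<star>\<^sub>q qi = qj" "qi \<star>\<^sub>q qk = - qj"
  by (simp_all add: qmult_def qreal_def)

text \<open>Averaging over the quaternion group yields an intertwiner \<open>x - I x i - J x j - K x k\<close> for every
  \<open>x\<close>; it cannot vanish for all basis quaternions \<open>x\<close> because \<open>x \<mapsto> I x i\<close> has trace \<open>0\<close>.\<close>
lemma quaternion_intertwiner:
  assumes II: "I \<star>\<^sub>q I = - qreal 1" and JJ: "J \<star>\<^sub>q J = - qreal 1" and JI: "J \<star>\<^sub>q I = - (I \<star>\<^sub>q J)"
  obtains u where "u \<noteq> 0" "I \<star>\<^sub>q u = u \<star>\<^sub>q qi" "J \<star>\<^sub>q u = u \<star>\<^sub>q qj"
proof -
  define K where "K = I \<star>\<^sub>q J"
  define U where "U x = x - I \<star>\<^sub>q (x \<star>\<^sub>q qi) - J \<star>\<^sub>q (x \<star>\<^sub>q qj) - K \<star>\<^sub>q (x \<star>\<^sub>q qk)" for x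
  have I: "I \<star>\<^sub>q (I \<star>\<^sub>q z) = - z" and J: "J \<star>\<^sub>q (J \<star>\<^sub>q z) = - z"
    and IJ: "I \<star>\<^sub>q (J \<star>\<^sub>q z) = K \<star>\<^sub>q z" and JI': "J \<star>\<^sub>q (I \<star>\<^sub>q z) = - (K \<star>\<^sub>q z)" for z
    using II JJ JI by (simp_all add: K_def qmult.minus_left flip: qmult_assoc)
  have IK: "I \<star>\<^sub>q (K \<star>\<^sub>q z) = - (J \<star>\<^sub>q z)" and JK: "J \<star>\<^sub>q (K \<star>\<^sub>q z) = I \<star>\<^sub>q z" for z
    using I J JI' by (simp_all flip: IJ add: qmult.minus_right)
  have "I \<star>\<^sub>q U x = U x \<star>\<^sub>q qi" "J \<star>\<^sub>q U x = U x \<star>\<^sub>q qj" for x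
    by (simp_all add: U_def qmult.diff_right qmult.diff_left qmult_assoc quat_units_mult
        I J IJ JI' IK JK qmult.minus_right del: uminus_Pair)
  moreover have "\<exists>x. U x \<noteq> 0"
  proof (rule ccontr)
    assume "\<nexists>x. U x \<noteq> 0"
    then have "U x \<bullet> x = 0" for x
      by (metis inner_zero_left)
    then have "U (qreal 1) \<bullet> qreal 1 + U qi \<bullet> qi + U qj \<bullet> qj + U qk \<bullet> qk = 0"
      by simp
    then show False
      by (cases I; cases J; cases K) (simp add: U_def qmult_def qreal_def)
  qed
  ultimately show ?thesis
    using that by blast
qed

text \<open>An instance of the Skolem-Noether theorem: \<open>A\<close> respects the multiplication
  table of the quaternion units, so the intertwiner satisfies A(q) u = u q on the basis and then
  everywhere. Normalizing \<open>u\<close> turns its inverse into its conjugate.\<close>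

lemma qrotate_surj:
  assumes "linear A" "A (qreal 1) = qreal 1" "A qk = A qi \<star>\<^sub>q A qj"
    and "A qi \<star>\<^sub>q A qi = - qreal 1" "A qj \<star>\<^sub>q A qj = - qreal 1" "A qj \<star>\<^sub>q A qi = - (A qi \<star>\<^sub>q A qj)"
  obtains u where "u \<in> Sp1" "\<And>q. A q = qrotate u q"
proof -
  obtain u where u: "u \<noteq> 0" "A qi \<star>\<^sub>q u = u \<star>\<^sub>q qi" "A qj \<star>\<^sub>q u = u \<star>\<^sub>q qj"
    using quaternion_intertwiner[OF assms(4-6)] .
  have "A qk \<star>\<^sub>q u = u \<star>\<^sub>q qk"
    unfolding assms(3) by (metis qmult_assoc quat_units_mult(4) u(2,3))
  then have Au: "A q \<star>\<^sub>q u = u \<star>\<^sub>q q" for q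
  proof -
    obtain a b c d where q: "q = (a, b, c, d)"
      by (cases q)
    have "A (a *\<^sub>R qreal 1 + b *\<^sub>R qi + c *\<^sub>R qj + d *\<^sub>R qk) \<star>\<^sub>q u =
        u \<star>\<^sub>q (a *\<^sub>R qreal 1 + b *\<^sub>R qi + c *\<^sub>R qj + d *\<^sub>R qk)"
      by (simp only: linear_add[OF assms(1)] linear_scale[OF assms(1)] assms(2)
          qmult.add_left qmult.add_right qmult.scaleR_left qmult.scaleR_right qreal_one_mult u(2,3)
          \<open>A qk \<star>\<^sub>q u = u \<star>\<^sub>q qk\<close>)
    then show ?thesis
      unfolding q quat_basis[of a b c d] .
  qed
  define v where "v = inverse (norm u) *\<^sub>R u"
  have "A q = qrotate v q" for q
  proof -
    have "A q = A q \<star>\<^sub>q u \<star>\<^sub>q qinv u"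
      by (simp add: qmult_assoc qinv_right[OF u(1)])
    also have "\<dots> = qrotate v q"
      unfolding Au
      by (simp add: qrotate_def v_def qinv_def linear_scale[OF linear_qcnj] qmult.scaleR_left
          qmult.scaleR_right qmult_assoc power2_eq_square divide_inverse)
    finally show ?thesis .
  qed
  moreover have "v \<in> Sp1"
    using u(1) by (simp add: v_def Sp1_def)
  ultimately show ?thesis
    using that by blast
qed

lemma imaginary_anticommute:
  "qre p = 0 \<Longrightarrow> qre q = 0 \<Longrightarrow> p \<star>\<^sub>q q + q \<star>\<^sub>q p = - (2 * (p \<bullet> q)) *\<^sub>R qreal 1"
  by (cases p; cases q) (simp add: qre_def qmult_def qreal_def)

lemma imaginary_square:
  assumes "qre p = 0"
  shows "p \<star>\<^sub>q p = - (p \<bullet> p) *\<^sub>R qreal 1"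
  using assms by (cases p) (simp add: qre_def qmult_def qreal_def)

text \<open>\<open>A\<close> preserves the imaginary space, and I J is orthogonal to 1, I and J, so
  it is A(k) up to sign. The plus sign makes \<open>A\<close> multiplicative and hence a rotation;
  for the minus sign, composition with \<open>qcnj\<close>, which is -1 on the imaginary space,
  restores it.\<close>

lemma orthogonal_fixing_one:
  assumes lin: "linear A" and inner: "\<And>p q. A p \<bullet> A q = p \<bullet> q" and one: "A (qreal 1) = qreal 1"
  obtains u e where "u \<in> Sp1" "e \<in> {1, -1}" "\<And>q. A q = qrotate u (qflip e q)"
proof -
  have inner_one: "q \<bullet> qreal 1 = qre q" for q
    by (cases q) (simp add: qreal_def qre_def)
  have qre: "qre (A q) = qre q" for q
    using inner[of q "qreal 1"] unfolding one inner_one .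
  define I J where "I = A qi" and "J = A qj"
  have re: "qre I = 0" "qre J = 0"
    unfolding I_def J_def qre by (simp_all add: qre_def)
  have ip: "I \<bullet> I = 1" "J \<bullet> J = 1" "I \<bullet> J = 0" "J \<bullet> I = 0"
    unfolding I_def J_def inner by simp_all
  have II: "I \<star>\<^sub>q I = - qreal 1" and JJ: "J \<star>\<^sub>q J = - qreal 1"
    using re ip by (simp_all add: imaginary_square)
  have JI: "J \<star>\<^sub>q I = - (I \<star>\<^sub>q J)"
    using imaginary_anticommute[OF re(2) re(1)] ip by (simp add: eq_neg_iff_add_eq_0)
  have "inj A"
    using inner lin by (metis inner_eq_zero_iff linear_injective_0)
  then have "surj A"
    by (rule linear_inj_imp_surj[OF lin])
  \<comment> \<open>Pulling I J back along \<open>A\<close> reduces the claim to coordinates: the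
    inner products of \<open>z\<close> with 1, i and j vanish, leaving a multiple of k of length
    1.\<close>
  then obtain z where z: "A z = I \<star>\<^sub>q J"
    by (metis surjD)
  obtain z0 z1 z2 d where z_eq: "z = (z0, z1, z2, d)"
    by (cases z)
  have "z \<bullet> qreal 1 = - (I \<bullet> J)"
    unfolding inner[symmetric, of z] one z using re
    by (cases I; cases J) (simp add: qmult_def qreal_def qre_def)
  moreover have "z \<bullet> qi = 0" "z \<bullet> qj = 0"
    unfolding inner[symmetric, of z] z I_def[symmetric] J_def[symmetric]
    using qmult_inner_left[of I J "qreal 1"] qmult_inner_right[of I J "qreal 1"] inner_one[of I]
      inner_one[of J] re
    by simp_all
  ultimately have z_d: "z = d *\<^sub>R qk"
    using ip by (simp add: z_eq qreal_def)
  have "norm I = 1" "norm J = 1"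
    using ip by (simp_all add: norm_eq_sqrt_inner)
  then have "norm (I \<star>\<^sub>q J) = 1"
    by (simp add: norm_qmult)
  then have "z \<bullet> z = 1"
    using inner[of z z] unfolding z by (simp flip: power2_norm_eq_inner)
  then have d: "d = 1 \<or> d = -1"
    by (simp add: z_d power2_eq_1_iff flip: power2_eq_square)
  have IJ: "I \<star>\<^sub>q J = d *\<^sub>R A qk"
    using z unfolding z_d by (simp only: linear_scale[OF lin])
  show ?thesis
    using d
  proof
    assume "d = 1"
    then have "A qk = A qi \<star>\<^sub>q A qj"
      using IJ by (simp flip: I_def J_def)
    then obtain u where "u \<in> Sp1" "\<And>q. A q = qrotate u q"
      using qrotate_surj[OF lin one _ II[unfolded I_def] JJ[unfolded J_def] JI[unfolded I_def J_def]]
      by blast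
    then show ?thesis
      using that[of u 1] by (simp add: qflip_def)
  next
    assume d: "d = -1"
    have cnj: "qcnj qi = - qi" "qcnj qj = - qj" "qcnj qk = - qk"
      by (simp_all add: qcnj_def)
    note neg = linear_neg[OF lin]
    obtain u where u: "u \<in> Sp1" "\<And>q. A (qcnj q) = qrotate u q"
    proof (rule qrotate_surj[of "\<lambda>q. A (qcnj q)"])
      show "linear (\<lambda>q. A (qcnj q))"
        using linear_compose[OF linear_qcnj lin] by (simp add: o_def)
      show "A (qcnj (qreal 1)) = qreal 1"
        by (simp add: one)
      show "A (qcnj qk) = A (qcnj qi) \<star>\<^sub>q A (qcnj qj)"
        unfolding cnj neg using IJ d by (simp add: qmult.minus_left qmult.minus_right flip: I_def J_def)
      show "A (qcnj qi) \<star>\<^sub>q A (qcnj qi) = - qreal 1" "A (qcnj qj) \<star>\<^sub>q A (qcnj qj) = - qreal 1"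
        "A (qcnj qj) \<star>\<^sub>q A (qcnj qi) = - (A (qcnj qi) \<star>\<^sub>q A (qcnj qj))"
        unfolding cnj neg using II JJ JI
        by (simp_all add: qmult.minus_left qmult.minus_right flip: I_def J_def)
    qed blast
    show ?thesis
      using that[of u "-1"] u(1) u(2)[of "qcnj q" for q] by (simp add: qflip_def)
  qed
qed

text \<open>Isotropy forces (b . v)^2 = |b|^2 for every unit imaginary \<open>v\<close>. Summing
  over three orthonormal directions yields |b|^2 = 3 |b|^2.\<close>

lemma isotropic_point_real:
  assumes "(x, b) \<in> qball" and iso: "\<And>\<beta>. slice_metric (x, b) \<beta> \<beta> = (norm \<beta>)\<^sup>2 / (1 - (norm (x, b))\<^sup>2)\<^sup>2"
  shows "b = 0"
proof -
  define n where "n = 1 - (norm (x, b))\<^sup>2"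
  have n: "n > 0"
    using qball_norm_power2[OF assms(1)] by (simp add: n_def)
  define D where "D = n\<^sup>2 + 4 * (norm b)\<^sup>2"
  have D: "D > 0"
    unfolding D_def using n by (simp add: add_pos_nonneg)
  have bv: "(b \<bullet> v)\<^sup>2 = (norm b)\<^sup>2" if "norm v = 1" for v
  proof -
    have nv: "(norm (0 :: real, v))\<^sup>2 = 1"
      using that by (simp add: norm_Pair)
    have "(n\<^sup>2 + 4 * (b \<bullet> v)\<^sup>2) / (D * n\<^sup>2) = 1 / n\<^sup>2"
      using iso[of "(0, v)"] unfolding slice_metric_quadratic nv n_def[symmetric] D_def by simp
    then have "(n\<^sup>2 + 4 * (b \<bullet> v)\<^sup>2) / (D * n\<^sup>2) * (D * n\<^sup>2) = 1 / n\<^sup>2 * (D * n\<^sup>2)"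
      by simp
    then have "n\<^sup>2 + 4 * (b \<bullet> v)\<^sup>2 = D"
      using n D by simp
    then show ?thesis
      by (simp add: D_def)
  qed
  obtain b1 b2 b3 where b: "b = (b1, b2, b3)"
    by (cases b)
  have "(norm b)\<^sup>2 = b1\<^sup>2 + b2\<^sup>2 + b3\<^sup>2"
    by (simp add: b norm_Pair)
  also have "\<dots> = 3 * (norm b)\<^sup>2"
    using bv[of "(1, 0, 0)"] bv[of "(0, 1, 0)"] bv[of "(0, 0, 1)"] by (simp add: b norm_Pair)
  finally show ?thesis
    by simp
qed

lemma metric_preserving_fixing_zero:
  assumes f: "metric_preserving f" and e: "metric_preserving e"
    and ef: "\<And>q. q \<in> qball \<Longrightarrow> e (f q) = q" and "f 0 = 0"
  obtains g where "g \<in> grp_carrier" "\<And>q. q \<in> qball \<Longrightarrow> f q = grp_act g q"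
proof -
  obtain L where lin: "linear L" and inner: "\<And>p q. L p \<bullet> L q = p \<bullet> q"
    and fL: "\<And>q. q \<in> qball \<Longrightarrow> f q = L q"
    using metric_preserving_fixing_zero_linear[OF assms] by blast
  have norm: "norm (L q) = norm q" for q
    by (simp add: norm_eq_sqrt_inner inner)
  have "inj L"
    using inner lin by (metis inner_eq_zero_iff linear_injective_0)
  then have surj: "surj L"
    by (rule linear_inj_imp_surj[OF lin])
  have metric: "slice_metric (L q) (L \<alpha>) (L \<alpha>) = slice_metric q \<alpha> \<alpha>" if q: "q \<in> qball" for q \<alpha>
  proof -
    obtain f' where f': "(f has_derivative f') (at q)"
      "\<And>\<alpha> \<beta>. slice_metric (f q) (f' \<alpha>) (f' \<beta>) = slice_metric q \<alpha> \<beta>"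
      using metric_preserving_derivative[OF f q] by blast
    have "(f has_derivative L) (at q)"
      by (rule has_derivative_transform_within_open[OF linear_imp_has_derivative[OF lin] open_qball q])
        (simp add: fL)
    then have "f' = L"
      using f'(1) by (rule has_derivative_unique[symmetric])
    then show ?thesis
      using f'(2) fL[OF q] by simp
  qed
  \<comment> \<open>A nonzero real point of the ball, at which the metric is isotropic. The
    orthogonal map \<open>L\<close> preserves the metric, so the metric is isotropic at
    \<open>L h\<close> as well, which is therefore real.\<close>
  define h where "h = qreal (1 / 2)"
  have h: "h \<in> qball" "L h \<in> qball"
    by (simp_all add: h_def qball_iff norm)
  obtain y b where Lh: "L h = (y, b)"
    by (cases "L h")
  have "b = 0"
  proof (rule isotropic_point_real)
    show "(y, b) \<in> qball"
      using h(2) unfolding Lh .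
    fix \<beta>
    obtain \<alpha> where \<alpha>: "\<beta> = L \<alpha>"
      using surj by (metis surjD)
    have "slice_metric h \<alpha> \<alpha> = (norm \<alpha>)\<^sup>2 / (1 - (norm h)\<^sup>2)\<^sup>2"
      using slice_metric_real[of "1 / 2" \<alpha>] unfolding h_def norm_qreal
      by (simp add: qreal_def flip: zero_prod_def)
    then show "slice_metric (y, b) \<beta> \<beta> = (norm \<beta>)\<^sup>2 / (1 - (norm (y, b))\<^sup>2)\<^sup>2"
      unfolding \<alpha> Lh[symmetric] metric[OF h(1)] norm .
  qed
  then have "L (qreal 1) = qreal (2 * y)"
    using linear_scale[OF lin, of 2 h] Lh by (simp add: h_def qreal_def zero_prod_def)
  moreover define s where "s = 2 * y"
  ultimately have L1: "L (qreal 1) = qreal s"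
    by simp
  then have "\<bar>s\<bar> = 1"
    using norm[of "qreal 1"] by simp
  then have "s = 1 \<or> s = -1"
    by linarith
  then have s: "s \<in> {1, -1}" "s * s = 1"
    by auto
  \<comment> \<open>Multiplying by the sign \<open>s\<close> yields an orthogonal map fixing
    1.\<close>
  obtain u d where u: "u \<in> Sp1" "d \<in> {1, -1}" and A: "\<And>q. s *\<^sub>R L q = qrotate u (qflip d q)"
  proof (rule orthogonal_fixing_one[of "\<lambda>q. s *\<^sub>R L q"])
    show "linear (\<lambda>q. s *\<^sub>R L q)"
      by (rule linear_compose_scale_right[OF lin])
    show "s *\<^sub>R L p \<bullet> s *\<^sub>R L q = p \<bullet> q" for p q
      using s(2) by (simp add: inner flip: mult.assoc)
    show "s *\<^sub>R L (qreal 1) = qreal 1"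
      unfolding L1 using s(2) by (simp add: qreal_def)
  qed blast
  have "L q = s *\<^sub>R qrotate u (qflip d q)" for q
    using s(2) by (simp flip: A)
  then have "f q = grp_act (u, (s, 0), d) q" if "q \<in> qball" for q
    using that by (simp add: fL grp_act_decompose)
  moreover have "(u, (s, 0), d) \<in> grp_carrier"
    using u s(1) by (auto simp: grp_carrier_def)
  ultimately show ?thesis
    using that by blast
qed

section \<open>Reduction of the general case to a fixed origin\<close>

lemma qmoebius_imaginary:
  assumes "q \<in> qball"
  obtains t where "qre (qmoebius (tanh t) q) = 0"
proof -
  obtain x y z w where q: "q = (x, y, z, w)"
    by (cases q)
  define N where "N = (norm q)\<^sup>2"
  have N: "N = x\<^sup>2 + y\<^sup>2 + z\<^sup>2 + w\<^sup>2"
    by (simp add: N_def q norm_Pair)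
  have "\<bar>x\<bar> \<le> norm q"
    using norm_fst_le[of x "(y, z, w)"] by (simp add: q)
  then have x: "\<bar>x\<bar> < 1"
    using assms by (simp add: qball_iff)
  \<comment> \<open>\<open>P s\<close> is the real part of the Moebius numerator after
    multiplication by the conjugate denominator. It is negative at -1 and positive at 1, so it has a
    zero strictly between, which is a value of tanh.\<close>
  define P where "P s = x + s * (1 + N) + s\<^sup>2 * x" for s
  have "P 1 = (1 + x)\<^sup>2 + (y\<^sup>2 + z\<^sup>2 + w\<^sup>2)" "P (-1) = - ((1 - x)\<^sup>2 + (y\<^sup>2 + z\<^sup>2 + w\<^sup>2))"
    by (simp_all add: P_def N power2_sum power2_diff)
  moreover have "(1 + x)\<^sup>2 + (y\<^sup>2 + z\<^sup>2 + w\<^sup>2) > 0" "(1 - x)\<^sup>2 + (y\<^sup>2 + z\<^sup>2 + w\<^sup>2) > 0"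
    using x by (auto intro!: add_pos_nonneg)
  ultimately have P1: "P 1 > 0" "P (-1) < 0"
    by linarith+
  have "continuous_on {-1..1} P"
    unfolding P_def by (intro continuous_intros)
  then obtain s where s: "-1 \<le> s" "s \<le> 1" "P s = 0"
    using IVT'[of P "-1" 0 1] P1 by auto
  then have "\<bar>s\<bar> < 1"
    using P1 by (cases "s = 1 \<or> s = -1") auto
  then have t: "tanh (artanh s) = s"
    by (rule tanh_artanh_real)
  have "qre (qcnj (qreal 1 + s *\<^sub>R q) \<star>\<^sub>q (q + qreal s)) = P s"
    by (simp add: q P_def N qre_def qcnj_def qreal_def qmult_def power2_eq_square algebra_simps)
  then have "qre (qmoebius s q) = 0"
    using s(3) by (simp add: qmoebius_def qinv_def qmult.scaleR_left qre_def)
  then show ?thesis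
    using that[of "artanh s"] by (simp add: t)
qed

lemma slice_isometry_in_group:
  assumes "slice_isometry f"
  obtains g where "g \<in> grp_carrier" "f = restrict (grp_act g) qball"
proof -
  define e where "e = inv_into qball f"
  have f: "metric_preserving f" and e: "metric_preserving e"
    using slice_isometry_metric_preserving[OF assms] by (simp_all add: e_def)
  have ef: "e (f q) = q" and fe: "f (e q) = q" if "q \<in> qball" for q
    using slice_isometry_inverse[OF assms that] by (simp_all add: e_def)
  have zero: "0 \<in> qball"
    by (simp add: qball_iff)
  obtain t where t: "qre (qmoebius (tanh t) (f 0)) = 0"
    using qmoebius_imaginary[OF metric_preserving_in_qball[OF f zero]] .
  \<comment> \<open>\<open>m\<close> translates \<open>f 0\<close> into the imaginary space, and
    \<open>m'\<close> undoes this. The composite of \<open>f\<close> with \<open>m\<close> must then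
    fix 0 and is given by a group element \<open>h\<close>; composing with \<open>m'\<close>
    recovers \<open>f\<close>.\<close>
  define m m' :: grp where "m = (qreal 1, (1, t), 1)" and "m' = (qreal 1, (1, - t), 1)"
  have carrier: "m \<in> grp_carrier" "m' \<in> grp_carrier"
    by (simp_all add: m_def m'_def grp_carrier_def Sp1_def)
  have "grp_mult m m' = grp_one" "grp_mult m' m = grp_one"
    by (simp_all add: m_def m'_def grp_mult_def grp_one_def)
  then have mm': "grp_act m (grp_act m' q) = q" "grp_act m' (grp_act m q) = q" if "q \<in> qball" for q
    using grp_act_mult[OF carrier that] grp_act_mult[OF carrier(2,1) that] by (simp_all add: grp_act_one)
  note m = metric_preserving_grp_act[OF carrier(1)] and m' = metric_preserving_grp_act[OF carrier(2)]
  note mf = metric_preserving_comp[OF m f] and em' = metric_preserving_comp[OF e m']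
  have inverse: "e (grp_act m' (grp_act m (f q))) = q" "grp_act m (f (e (grp_act m' q))) = q"
    if "q \<in> qball" for q
    using that mm' ef fe metric_preserving_in_qball[OF f] metric_preserving_in_qball[OF m'] by auto
  have "fst (grp_act m (f 0)) = 0"
    using t by (simp add: m_def grp_act_decompose qrotate_def qflip_def qre_def)
  then have "grp_act m (f 0) = 0"
    using metric_preserving_imaginary_zero[OF mf em'] inverse by blast
  then obtain h where h: "h \<in> grp_carrier" "\<And>q. q \<in> qball \<Longrightarrow> grp_act m (f q) = grp_act h q"
    using metric_preserving_fixing_zero[OF mf em'] inverse(1) by blast
  have "f q = grp_act (grp_mult m' h) q" if q: "q \<in> qball" for q
    using h(2)[OF q] mm'(2)[OF metric_preserving_in_qball[OF f q]] grp_act_mult[OF carrier(2) h(1) q]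
    by simp
  moreover have "f \<in> extensional qball"
    using assms by (simp add: slice_isometry_def)
  ultimately have "f = restrict (grp_act (grp_mult m' h)) qball"
    by (intro extensionalityI[of f qball]) auto
  then show ?thesis
    using that[OF grp_mult_closed[OF carrier(2) h(1)]] by blast
qed

theorem theorem3p4:
  shows "(\<forall>g\<in>grp_carrier. \<forall>q\<in>qball. grp_act g q \<in> qball)
    \<and> (\<forall>q\<in>qball. grp_act grp_one q = q)
    \<and> (\<forall>g\<in>grp_carrier. \<forall>h\<in>grp_carrier. \<forall>q\<in>qball.
          grp_act (grp_mult g h) q = grp_act g (grp_act h q))
    \<and> (\<lambda>g. restrict (grp_act g) qball) ` grp_carrier = {f. slice_isometry f}"
proof (intro conjI ballI)
  show "(\<lambda>g. restrict (grp_act g) qball) ` grp_carrier = {f. slice_isometry f}"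
  proof (intro equalityI subsetI)
    fix f assume "f \<in> {f. slice_isometry f}"
    then obtain g where "g \<in> grp_carrier" "f = restrict (grp_act g) qball"
      using slice_isometry_in_group by blast
    then show "f \<in> (\<lambda>g. restrict (grp_act g) qball) ` grp_carrier"
      by blast
  qed (use slice_isometry_grp_act in blast)
qed (simp_all add: grp_act_in_qball grp_act_one grp_act_mult)

end
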